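(* For any $\otimes$-category $\mathcal{C}$, the topological space $\operatorname{Spec}^\otimes\mathcal{C}$ is a spectral space. For any $\otimes$-functor $F:\mathcal{C}\to\mathcal{D}$ between $\otimes$-categories, the map $F^*:\operatorname{Spec}^\otimes\mathcal{D}\to\operatorname{Spec}^\otimes\mathcal{C}$, $\mathbb{P}\mapsto F^{-1}(\mathbb{P})$, is a spectral map.
   Context: A $\otimes$-category is an additive symmetric monoidal category with unit $\mathbf{1}$ and biadditive tensor product (not assumed rigid); a $\otimes$-functor is a strong symmetric monoidal unital additive functor. A $\otimes$-ideal $\mathbb{I}$ of $\mathcal{C}$ is a two-sided additive ideal (subgroups $\mathbb{I}(A,B)\subseteq\mathcal{C}(A,B)$ stable under left and right composition) stable under tensor product with arbitrary morphisms of $\mathcal{C}$; $\mathcal{C}/\mathbb{I}$ is the quotient $\otimes$-category. A $\otimes$-category is integral if $f\otimes g=0$ implies $f=0$ or $g=0$ for morphisms $f,g$. A $\otimes$-ideal $\mathbb{P}\subsetneq\mathcal{C}$ is prime if $\mathcal{C}/\mathbb{P}$ is integral. $\operatorname{Spec}^\otimes\mathcal{C}$ is the set of prime $\otimes$-ideals of $\mathcal{C}$, with the topology whose closed subsets are the $V(\mathbb{I})=\{\mathbb{P}\mid\mathbb{I}\subseteq\mathbb{P}\}$ for $\mathbb{I}$ a $\otimes$-ideal. A topological space is spectral (Hochster) if it is $T_0$ and quasi-compact, its quasi-compact open subsets are closed under finite intersection and form an open basis, and every nonempty irreducible closed subset has a generic point. A continuous map of spectral spaces is spectral if inverse images of quasi-compact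 open sets are quasi-compact. *)

theory Defs
  imports "HOL-Analysis.Abstract_Topological_Spaces" "HOL-Algebra.Coset"
begin

section \<open>Additive symmetric monoidal categories\<close>

text \<open>
  A category is given by its set \<open>Ob\<close> of objects and its set \<open>Arr\<close> of arrows, every arrow having
  one domain and one codomain, so that the hom-sets are pairwise disjoint.
  \<open>g \<cdot> f\<close> is the composite of \<open>g\<close> after \<open>f\<close>. The operations are relevant only on \<open>Ob\<close> and \<open>Arr\<close>.
\<close>

record ('o, 'm) tcat =
  Ob :: "'o set"
  Arr :: "'m set"
  Dom :: "'m \<Rightarrow> 'o"
  Cod :: "'m \<Rightarrow> 'o"
  Id :: "'o \<Rightarrow> 'm"
  Comp :: "'m \<Rightarrow> 'm \<Rightarrow> 'm"  (infixr \<open>\<cdot>\<index>\<close> 70)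
  Zero :: "'o \<Rightarrow> 'o \<Rightarrow> 'm"
  Add :: "'m \<Rightarrow> 'm \<Rightarrow> 'm"  (infixl \<open>\<boxplus>\<index>\<close> 65)
  TensO :: "'o \<Rightarrow> 'o \<Rightarrow> 'o"  (infixl \<open>\<odot>\<index>\<close> 75)
  TensA :: "'m \<Rightarrow> 'm \<Rightarrow> 'm"  (infixl \<open>\<boxtimes>\<index>\<close> 75)
  Unit :: 'o
  Assoc :: "'o \<Rightarrow> 'o \<Rightarrow> 'o \<Rightarrow> 'm"
  LUnit :: "'o \<Rightarrow> 'm"
  RUnit :: "'o \<Rightarrow> 'm"
  Sym :: "'o \<Rightarrow> 'o \<Rightarrow> 'm"

definition Hom :: "('o, 'm) tcat \<Rightarrow> 'o \<Rightarrow> 'o \<Rightarrow> 'm set" where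
  "Hom C A B = {f \<in> Arr C. Dom C f = A \<and> Cod C f = B}"

definition hom_group :: "('o, 'm) tcat \<Rightarrow> 'o \<Rightarrow> 'o \<Rightarrow> 'm monoid" where
  "hom_group C A B = \<lparr>carrier = Hom C A B, mult = Add C, one = Zero C A B\<rparr>"

definition iso_arr :: "('o, 'm) tcat \<Rightarrow> 'm \<Rightarrow> bool" where
  "iso_arr C f \<longleftrightarrow> f \<in> Arr C \<and>
     (\<exists>g \<in> Hom C (Cod C f) (Dom C f).
        Comp C g f = Id C (Dom C f) \<and> Comp C f g = Id C (Cod C f))"

locale category =
  fixes C :: "('o, 'm) tcat" (structure)
  assumes dom_in_Ob: "f \<in> Arr C \<Longrightarrow> Dom C f \<in> Ob C"
    and cod_in_Ob: "f \<in> Arr C \<Longrightarrow> Cod C f \<in> Ob C"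
    and Id_in_Hom: "A \<in> Ob C \<Longrightarrow> Id C A \<in> Hom C A A"
    and Comp_in_Hom: "\<lbrakk>f \<in> Hom C A B; g \<in> Hom C B D\<rbrakk> \<Longrightarrow> g \<cdot> f \<in> Hom C A D"
    and Comp_Id_right: "f \<in> Hom C A B \<Longrightarrow> f \<cdot> Id C A = f"
    and Comp_Id_left: "f \<in> Hom C A B \<Longrightarrow> Id C B \<cdot> f = f"
    and Comp_assoc: "\<lbrakk>f \<in> Hom C A B; g \<in> Hom C B D; h \<in> Hom C D E\<rbrakk>
      \<Longrightarrow> (h \<cdot> g) \<cdot> f = h \<cdot> (g \<cdot> f)"

locale additive_category = category +
  assumes hom_comm_group: "\<lbrakk>A \<in> Ob C; B \<in> Ob C\<rbrakk> \<Longrightarrow> comm_group (hom_group C A B)"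
    and Comp_Add_left: "\<lbrakk>f \<in> Hom C A B; g \<in> Hom C B D; g' \<in> Hom C B D\<rbrakk>
      \<Longrightarrow> (g \<boxplus> g') \<cdot> f = g \<cdot> f \<boxplus> g' \<cdot> f"
    and Comp_Add_right: "\<lbrakk>f \<in> Hom C A B; f' \<in> Hom C A B; g \<in> Hom C B D\<rbrakk>
      \<Longrightarrow> g \<cdot> (f \<boxplus> f') = g \<cdot> f \<boxplus> g \<cdot> f'"
    and zero_object: "\<exists>Z \<in> Ob C. \<forall>A \<in> Ob C. (\<exists>!f. f \<in> Hom C Z A) \<and> (\<exists>!f. f \<in> Hom C A Z)"
    and biproducts: "\<lbrakk>A \<in> Ob C; B \<in> Ob C\<rbrakk> \<Longrightarrow>
      \<exists>S \<in> Ob C. \<exists>i \<in> Hom C A S. \<exists>j \<in> Hom C B S. \<exists>p \<in> Hom C S A. \<exists>q \<in> Hom C S B.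
        p \<cdot> i = Id C A \<and> q \<cdot> j = Id C B \<and> p \<cdot> j = Zero C B A \<and> q \<cdot> i = Zero C A B \<and>
        i \<cdot> p \<boxplus> j \<cdot> q = Id C S"

text \<open>
  The constraints are
  \<open>Assoc A B D : (A \<odot> B) \<odot> D \<rightarrow> A \<odot> (B \<odot> D)\<close>, \<open>LUnit A : Unit \<odot> A \<rightarrow> A\<close>,
  \<open>RUnit A : A \<odot> Unit \<rightarrow> A\<close> and \<open>Sym A B : A \<odot> B \<rightarrow> B \<odot> A\<close>.
\<close>

locale tensor_category = additive_category +
  assumes TensO_in_Ob: "\<lbrakk>A \<in> Ob C; B \<in> Ob C\<rbrakk> \<Longrightarrow> A \<odot> B \<in> Ob C"
    and Unit_in_Ob: "Unit C \<in> Ob C"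
    and TensA_in_Hom: "\<lbrakk>f \<in> Hom C A B; g \<in> Hom C A' B'\<rbrakk> \<Longrightarrow> f \<boxtimes> g \<in> Hom C (A \<odot> A') (B \<odot> B')"
    and TensA_Id: "\<lbrakk>A \<in> Ob C; B \<in> Ob C\<rbrakk> \<Longrightarrow> Id C A \<boxtimes> Id C B = Id C (A \<odot> B)"
    and TensA_Comp: "\<lbrakk>f \<in> Hom C A B; g \<in> Hom C B D; f' \<in> Hom C A' B'; g' \<in> Hom C B' D'\<rbrakk>
      \<Longrightarrow> (g \<cdot> f) \<boxtimes> (g' \<cdot> f') = (g \<boxtimes> g') \<cdot> (f \<boxtimes> f')"
    and TensA_Add_left: "\<lbrakk>f \<in> Hom C A B; f' \<in> Hom C A B; g \<in> Hom C A' B'\<rbrakk>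
      \<Longrightarrow> (f \<boxplus> f') \<boxtimes> g = f \<boxtimes> g \<boxplus> f' \<boxtimes> g"
    and TensA_Add_right: "\<lbrakk>f \<in> Hom C A B; g \<in> Hom C A' B'; g' \<in> Hom C A' B'\<rbrakk>
      \<Longrightarrow> f \<boxtimes> (g \<boxplus> g') = f \<boxtimes> g \<boxplus> f \<boxtimes> g'"
    and Assoc_in_Hom: "\<lbrakk>A \<in> Ob C; B \<in> Ob C; D \<in> Ob C\<rbrakk>
      \<Longrightarrow> Assoc C A B D \<in> Hom C ((A \<odot> B) \<odot> D) (A \<odot> (B \<odot> D))"
    and Assoc_iso: "\<lbrakk>A \<in> Ob C; B \<in> Ob C; D \<in> Ob C\<rbrakk> \<Longrightarrow> iso_arr C (Assoc C A B D)"
    and Assoc_natural: "\<lbrakk>f \<in> Hom C A A'; g \<in> Hom C B B'; h \<in> Hom C D D'\<rbrakk>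
      \<Longrightarrow> Assoc C A' B' D' \<cdot> ((f \<boxtimes> g) \<boxtimes> h) = (f \<boxtimes> (g \<boxtimes> h)) \<cdot> Assoc C A B D"
    and LUnit_in_Hom: "A \<in> Ob C \<Longrightarrow> LUnit C A \<in> Hom C (Unit C \<odot> A) A"
    and LUnit_iso: "A \<in> Ob C \<Longrightarrow> iso_arr C (LUnit C A)"
    and LUnit_natural: "f \<in> Hom C A B \<Longrightarrow> LUnit C B \<cdot> (Id C (Unit C) \<boxtimes> f) = f \<cdot> LUnit C A"
    and RUnit_in_Hom: "A \<in> Ob C \<Longrightarrow> RUnit C A \<in> Hom C (A \<odot> Unit C) A"
    and RUnit_iso: "A \<in> Ob C \<Longrightarrow> iso_arr C (RUnit C A)"
    and RUnit_natural: "f \<in> Hom C A B \<Longrightarrow> RUnit C B \<cdot> (f \<boxtimes> Id C (Unit C)) = f \<cdot> RUnit C A"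
    and Sym_in_Hom: "\<lbrakk>A \<in> Ob C; B \<in> Ob C\<rbrakk> \<Longrightarrow> Sym C A B \<in> Hom C (A \<odot> B) (B \<odot> A)"
    and Sym_natural: "\<lbrakk>f \<in> Hom C A A'; g \<in> Hom C B B'\<rbrakk>
      \<Longrightarrow> Sym C A' B' \<cdot> (f \<boxtimes> g) = (g \<boxtimes> f) \<cdot> Sym C A B"
    and Sym_Sym: "\<lbrakk>A \<in> Ob C; B \<in> Ob C\<rbrakk> \<Longrightarrow> Sym C B A \<cdot> Sym C A B = Id C (A \<odot> B)"
    and pentagon: "\<lbrakk>A \<in> Ob C; B \<in> Ob C; D \<in> Ob C; E \<in> Ob C\<rbrakk> \<Longrightarrow>
      Assoc C A B (D \<odot> E) \<cdot> Assoc C (A \<odot> B) D E =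
      (Id C A \<boxtimes> Assoc C B D E) \<cdot> Assoc C A (B \<odot> D) E \<cdot> (Assoc C A B D \<boxtimes> Id C E)"
    and triangle: "\<lbrakk>A \<in> Ob C; B \<in> Ob C\<rbrakk> \<Longrightarrow>
      (Id C A \<boxtimes> LUnit C B) \<cdot> Assoc C A (Unit C) B = RUnit C A \<boxtimes> Id C B"
    and hexagon: "\<lbrakk>A \<in> Ob C; B \<in> Ob C; D \<in> Ob C\<rbrakk> \<Longrightarrow>
      Assoc C B D A \<cdot> Sym C A (B \<odot> D) \<cdot> Assoc C A B D =
      (Id C B \<boxtimes> Sym C A D) \<cdot> Assoc C B A D \<cdot> (Sym C A B \<boxtimes> Id C D)"


section \<open>Strong symmetric monoidal additive functors\<close>

text \<open>
  The structure isomorphisms are \<open>FMu F A B : F A \<odot> F B \<rightarrow> F (A \<odot> B)\<close> and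
  \<open>FEps F : Unit \<rightarrow> F Unit\<close>.
\<close>

record ('o, 'm, 'p, 'n) tfun =
  FOb :: "'o \<Rightarrow> 'p"
  FArr :: "'m \<Rightarrow> 'n"
  FMu :: "'o \<Rightarrow> 'o \<Rightarrow> 'n"
  FEps :: 'n

locale tensor_functor = C: tensor_category C + D: tensor_category D
  for C :: "('o, 'm) tcat" and D :: "('p, 'n) tcat" +
  fixes F :: "('o, 'm, 'p, 'n) tfun"
  assumes FOb_in_Ob: "A \<in> Ob C \<Longrightarrow> FOb F A \<in> Ob D"
    and FArr_in_Hom: "f \<in> Hom C A B \<Longrightarrow> FArr F f \<in> Hom D (FOb F A) (FOb F B)"
    and FArr_Id: "A \<in> Ob C \<Longrightarrow> FArr F (Id C A) = Id D (FOb F A)"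
    and FArr_Comp: "\<lbrakk>f \<in> Hom C A B; g \<in> Hom C B E\<rbrakk>
      \<Longrightarrow> FArr F (g \<cdot>\<^bsub>C\<^esub> f) = FArr F g \<cdot>\<^bsub>D\<^esub> FArr F f"
    and FArr_Add: "\<lbrakk>f \<in> Hom C A B; g \<in> Hom C A B\<rbrakk>
      \<Longrightarrow> FArr F (f \<boxplus>\<^bsub>C\<^esub> g) = FArr F f \<boxplus>\<^bsub>D\<^esub> FArr F g"
    and FMu_in_Hom: "\<lbrakk>A \<in> Ob C; B \<in> Ob C\<rbrakk>
      \<Longrightarrow> FMu F A B \<in> Hom D (FOb F A \<odot>\<^bsub>D\<^esub> FOb F B) (FOb F (A \<odot>\<^bsub>C\<^esub> B))"
    and FMu_iso: "\<lbrakk>A \<in> Ob C; B \<in> Ob C\<rbrakk> \<Longrightarrow> iso_arr D (FMu F A B)"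
    and FMu_natural: "\<lbrakk>f \<in> Hom C A A'; g \<in> Hom C B B'\<rbrakk>
      \<Longrightarrow> FMu F A' B' \<cdot>\<^bsub>D\<^esub> (FArr F f \<boxtimes>\<^bsub>D\<^esub> FArr F g) = FArr F (f \<boxtimes>\<^bsub>C\<^esub> g) \<cdot>\<^bsub>D\<^esub> FMu F A B"
    and FEps_in_Hom: "FEps F \<in> Hom D (Unit D) (FOb F (Unit C))"
    and FEps_iso: "iso_arr D (FEps F)"
    and F_Assoc: "\<lbrakk>A \<in> Ob C; B \<in> Ob C; E \<in> Ob C\<rbrakk> \<Longrightarrow>
      FArr F (Assoc C A B E) \<cdot>\<^bsub>D\<^esub> FMu F (A \<odot>\<^bsub>C\<^esub> B) E \<cdot>\<^bsub>D\<^esub> (FMu F A B \<boxtimes>\<^bsub>D\<^esub> Id D (FOb F E)) =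
      FMu F A (B \<odot>\<^bsub>C\<^esub> E) \<cdot>\<^bsub>D\<^esub> (Id D (FOb F A) \<boxtimes>\<^bsub>D\<^esub> FMu F B E)
        \<cdot>\<^bsub>D\<^esub> Assoc D (FOb F A) (FOb F B) (FOb F E)"
    and F_LUnit: "A \<in> Ob C \<Longrightarrow>
      FArr F (LUnit C A) \<cdot>\<^bsub>D\<^esub> FMu F (Unit C) A \<cdot>\<^bsub>D\<^esub> (FEps F \<boxtimes>\<^bsub>D\<^esub> Id D (FOb F A)) = LUnit D (FOb F A)"
    and F_RUnit: "A \<in> Ob C \<Longrightarrow>
      FArr F (RUnit C A) \<cdot>\<^bsub>D\<^esub> FMu F A (Unit C) \<cdot>\<^bsub>D\<^esub> (Id D (FOb F A) \<boxtimes>\<^bsub>D\<^esub> FEps F) = RUnit D (FOb F A)"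
    and F_Sym: "\<lbrakk>A \<in> Ob C; B \<in> Ob C\<rbrakk> \<Longrightarrow>
      FArr F (Sym C A B) \<cdot>\<^bsub>D\<^esub> FMu F A B = FMu F B A \<cdot>\<^bsub>D\<^esub> Sym D (FOb F A) (FOb F B)"


section \<open>Tensor ideals and quotients\<close>

text \<open>
  Hom-sets being disjoint, an ideal is encoded as the set of all its arrows; its component at
  \<open>(A, B)\<close> is \<open>I \<inter> Hom C A B\<close>.
\<close>

definition tensor_ideal :: "('o, 'm) tcat \<Rightarrow> 'm set \<Rightarrow> bool" where
  "tensor_ideal C I \<longleftrightarrow>
     I \<subseteq> Arr C \<and>
     (\<forall>A \<in> Ob C. \<forall>B \<in> Ob C. subgroup (I \<inter> Hom C A B) (hom_group C A B)) \<and>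
     (\<forall>f \<in> I. \<forall>g \<in> Arr C. Dom C g = Cod C f \<longrightarrow> Comp C g f \<in> I) \<and>
     (\<forall>f \<in> I. \<forall>g \<in> Arr C. Cod C g = Dom C f \<longrightarrow> Comp C f g \<in> I) \<and>
     (\<forall>f \<in> I. \<forall>g \<in> Arr C. TensA C f g \<in> I \<and> TensA C g f \<in> I)"

definition ideal_class :: "('o, 'm) tcat \<Rightarrow> 'm set \<Rightarrow> 'm \<Rightarrow> 'm set" where
  "ideal_class C I f =
     (I \<inter> Hom C (Dom C f) (Cod C f)) #>\<^bsub>hom_group C (Dom C f) (Cod C f)\<^esub> f"

text \<open>
  The arrows of \<open>C/I\<close> are the cosets of the groups \<open>I(A,B)\<close> in \<open>C(A,B)\<close>. The unions in the
  operations below are over representatives: the sets joined all coincide.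
\<close>

definition quotient_category :: "('o, 'm) tcat \<Rightarrow> 'm set \<Rightarrow> ('o, 'm set) tcat" where
  "quotient_category C I =
    \<lparr>Ob = Ob C,
     Arr = ideal_class C I ` Arr C,
     Dom = (\<lambda>X. the_elem (Dom C ` X)),
     Cod = (\<lambda>X. the_elem (Cod C ` X)),
     Id = (\<lambda>A. ideal_class C I (Id C A)),
     Comp = (\<lambda>Y X. \<Union>g \<in> Y. \<Union>f \<in> X. ideal_class C I (Comp C g f)),
     Zero = (\<lambda>A B. ideal_class C I (Zero C A B)),
     Add = (\<lambda>X Y. \<Union>f \<in> X. \<Union>g \<in> Y. ideal_class C I (Add C f g)),
     TensO = TensO C,
     TensA = (\<lambda>X Y. \<Union>f \<in> X. \<Union>g \<in> Y. ideal_class C I (TensA C f g)),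
     Unit = Unit C,
     Assoc = (\<lambda>A B D. ideal_class C I (Assoc C A B D)),
     LUnit = (\<lambda>A. ideal_class C I (LUnit C A)),
     RUnit = (\<lambda>A. ideal_class C I (RUnit C A)),
     Sym = (\<lambda>A B. ideal_class C I (Sym C A B))\<rparr>"

definition integral_category :: "('o, 'm) tcat \<Rightarrow> bool" where
  "integral_category C \<longleftrightarrow>
     (\<forall>f \<in> Arr C. \<forall>g \<in> Arr C.
        TensA C f g = Zero C (TensO C (Dom C f) (Dom C g)) (TensO C (Cod C f) (Cod C g)) \<longrightarrow>
        f = Zero C (Dom C f) (Cod C f) \<or> g = Zero C (Dom C g) (Cod C g))"

definition prime_tensor_ideal :: "('o, 'm) tcat \<Rightarrow> 'm set \<Rightarrow> bool" where
  "prime_tensor_ideal C P \<longleftrightarrow>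
     tensor_ideal C P \<and> P \<noteq> Arr C \<and> integral_category (quotient_category C P)"


section \<open>The spectrum\<close>

definition tensor_primes :: "('o, 'm) tcat \<Rightarrow> 'm set set" where
  "tensor_primes C = {P. prime_tensor_ideal C P}"

definition vanishing :: "('o, 'm) tcat \<Rightarrow> 'm set \<Rightarrow> 'm set set" where
  "vanishing C I = {P \<in> tensor_primes C. I \<subseteq> P}"

definition tensor_Spec :: "('o, 'm) tcat \<Rightarrow> 'm set topology" where
  "tensor_Spec C = topology (\<lambda>U. \<exists>I. tensor_ideal C I \<and> U = tensor_primes C - vanishing C I)"

definition ideal_preimage ::
    "('o, 'm) tcat \<Rightarrow> ('o, 'm, 'p, 'n) tfun \<Rightarrow> 'n set \<Rightarrow> 'm set" where
  "ideal_preimage C F P = {f \<in> Arr C. FArr F f \<in> P}"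


section \<open>Spectral spaces and spectral maps\<close>

definition irreducible_in :: "'a topology \<Rightarrow> 'a set \<Rightarrow> bool" where
  "irreducible_in X Z \<longleftrightarrow>
     Z \<subseteq> topspace X \<and> Z \<noteq> {} \<and>
     (\<forall>S T. closedin X S \<and> closedin X T \<and> Z \<subseteq> S \<union> T \<longrightarrow> Z \<subseteq> S \<or> Z \<subseteq> T)"

definition spectral_space :: "'a topology \<Rightarrow> bool" where
  "spectral_space X \<longleftrightarrow>
     t0_space X \<and>
     compact_space X \<and>
     (\<forall>U V. openin X U \<and> compactin X U \<and> openin X V \<and> compactin X V \<longrightarrow> compactin X (U \<inter> V)) \<and>
     openin X = arbitrary union_of (\<lambda>U. openin X U \<and> compactin X U) \<and>
     (\<forall>Z. closedin X Z \<and> irreducible_in X Z \<longrightarrow> (\<exists>x \<in> topspace X. X closure_of {x} = Z))"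

definition spectral_map :: "'a topology \<Rightarrow> 'b topology \<Rightarrow> ('a \<Rightarrow> 'b) \<Rightarrow> bool" where
  "spectral_map X Y f \<longleftrightarrow>
     continuous_map X Y f \<and>
     (\<forall>U. openin Y U \<and> compactin Y U \<longrightarrow> compactin X {x \<in> topspace X. f x \<in> U})"


section \<open>The quotient is a tensor category, and the closed sets form a topology\<close>

context additive_category begin

lemma hom_group_simps [simp]:
  "carrier (hom_group C A B) = Hom C A B" "mult (hom_group C A B) = Add C"
  "one (hom_group C A B) = Zero C A B"
  by (simp_all add: hom_group_def)

lemma HomD: "f \<in> Hom C A B \<Longrightarrow> f \<in> Arr C \<and> Dom C f = A \<and> Cod C f = B \<and> A \<in> Ob C \<and> B \<in> Ob C"
  using dom_in_Ob cod_in_Ob by (auto simp: Hom_def)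

lemma ArrD: "f \<in> Arr C \<Longrightarrow> f \<in> Hom C (Dom C f) (Cod C f)"
  by (simp add: Hom_def)

lemma Add_in_Hom: "f \<in> Hom C A B \<Longrightarrow> g \<in> Hom C A B \<Longrightarrow> f \<boxplus> g \<in> Hom C A B"
  using hom_comm_group[of A B] HomD[of f A B] comm_groupE(1)[of "hom_group C A B" f g] by simp

lemma Zero_in_Hom: "A \<in> Ob C \<Longrightarrow> B \<in> Ob C \<Longrightarrow> Zero C A B \<in> Hom C A B"
  using hom_comm_group[of A B] comm_groupE(2)[of "hom_group C A B"] by simp

lemma Add_assoc: "f \<in> Hom C A B \<Longrightarrow> g \<in> Hom C A B \<Longrightarrow> h \<in> Hom C A B \<Longrightarrow> (f \<boxplus> g) \<boxplus> h = f \<boxplus> (g \<boxplus> h)"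
  using hom_comm_group[of A B] HomD[of f A B] comm_groupE(3)[of "hom_group C A B" f g h] by simp

lemma Add_Zero: "f \<in> Hom C A B \<Longrightarrow> Zero C A B \<boxplus> f = f"
  using hom_comm_group[of A B] HomD[of f A B] comm_groupE(5)[of "hom_group C A B" f] by simp

lemma idem_Zero: "f \<in> Hom C A B \<Longrightarrow> f \<boxplus> f = f \<Longrightarrow> f = Zero C A B"
proof -
  assume f: "f \<in> Hom C A B" and e: "f \<boxplus> f = f"
  interpret comm_group "hom_group C A B" using hom_comm_group HomD[OF f] by blast
  show ?thesis using r_cancel_one[of f f] f e by simp
qed

end

locale tensor_ideal_in = tensor_category +
  fixes I
  assumes I: "tensor_ideal C I"
begin

abbreviation "cls \<equiv> ideal_class C I"
abbreviation "Q \<equiv> quotient_category C I"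

lemma subg: "A \<in> Ob C \<Longrightarrow> B \<in> Ob C \<Longrightarrow> subgroup (I \<inter> Hom C A B) (hom_group C A B)"
  using I by (simp add: tensor_ideal_def)

lemma cls_coset: "f \<in> Hom C A B \<Longrightarrow> cls f = (I \<inter> Hom C A B) #>\<^bsub>hom_group C A B\<^esub> f"
  by (auto simp: ideal_class_def Hom_def)

lemma mem_cls: "f \<in> Hom C A B \<Longrightarrow> f' \<in> cls f \<longleftrightarrow> (\<exists>h \<in> I \<inter> Hom C A B. f' = h \<boxplus> f)"
  by (auto simp: cls_coset r_coset_def)

lemma cls_Hom: "f \<in> Hom C A B \<Longrightarrow> f' \<in> cls f \<Longrightarrow> f' \<in> Hom C A B"
  by (auto simp: mem_cls Add_in_Hom)

lemma grp: "f \<in> Hom C A B \<Longrightarrow> group (hom_group C A B)"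
  using hom_comm_group[of A B] HomD[of f A B] by (simp add: comm_group_def)

lemma cls_self: "f \<in> Hom C A B \<Longrightarrow> f \<in> cls f"
  using group.rcos_self[OF grp, of f A B f] subg[of A B] HomD[of f A B] by (simp add: cls_coset)

lemma cls_eq: "f \<in> Hom C A B \<Longrightarrow> f' \<in> cls f \<Longrightarrow> cls f' = cls f"
  using group.repr_independence[OF grp, of f A B f' _ f] subg[of A B] HomD[of f A B] cls_Hom[of f A B f']
  by (simp add: cls_coset)

lemma Icomp1: "h \<in> I \<inter> Hom C A B \<Longrightarrow> g \<in> Hom C B D \<Longrightarrow> g \<cdot> h \<in> I \<inter> Hom C A D"
  using I Comp_in_Hom[of h A B g D] by (auto simp: tensor_ideal_def Hom_def)

lemma Icomp2: "h \<in> I \<inter> Hom C B D \<Longrightarrow> g \<in> Hom C A B \<Longrightarrow> h \<cdot> g \<in> I \<inter> Hom C A D"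
  using I Comp_in_Hom[of g A B h D] by (auto simp: tensor_ideal_def Hom_def)

lemma Itens: "h \<in> I \<inter> Hom C A B \<Longrightarrow> g \<in> Hom C A' B' \<Longrightarrow> h \<boxtimes> g \<in> I \<inter> Hom C (A \<odot> A') (B \<odot> B')"
  "h \<in> I \<inter> Hom C A B \<Longrightarrow> g \<in> Hom C A' B' \<Longrightarrow> g \<boxtimes> h \<in> I \<inter> Hom C (A' \<odot> A) (B' \<odot> B)"
  using I TensA_in_Hom[of h A B g A' B'] TensA_in_Hom[of g A' B' h A B] by (auto simp: tensor_ideal_def Hom_def)

lemma clsI: "f \<in> Hom C A B \<Longrightarrow> h \<in> I \<inter> Hom C A B \<Longrightarrow> h \<boxplus> f \<in> cls f"
  by (auto simp: mem_cls)

lemma comp_cls1: assumes "f \<in> Hom C A B" "g \<in> Hom C B D" "f' \<in> cls f" shows "g \<cdot> f' \<in> cls (g \<cdot> f)"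
proof -
  obtain h where h: "h \<in> I \<inter> Hom C A B" "f' = h \<boxplus> f" using assms mem_cls by blast
  have "g \<cdot> f' = g \<cdot> h \<boxplus> g \<cdot> f" using h assms Comp_Add_right by auto
  then show ?thesis using clsI[OF Comp_in_Hom[OF assms(1,2)]] Icomp1[OF h(1) assms(2)] by metis
qed

lemma comp_cls2: assumes "f \<in> Hom C A B" "g \<in> Hom C B D" "g' \<in> cls g" shows "g' \<cdot> f \<in> cls (g \<cdot> f)"
proof -
  obtain h where h: "h \<in> I \<inter> Hom C B D" "g' = h \<boxplus> g" using assms mem_cls by blast
  have "g' \<cdot> f = h \<cdot> f \<boxplus> g \<cdot> f" using h assms Comp_Add_left by auto
  then show ?thesis using clsI[OF Comp_in_Hom[OF assms(1,2)]] Icomp2[OF h(1) assms(1)] by metis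
qed

lemma tens_cls1: assumes "f \<in> Hom C A B" "g \<in> Hom C A' B'" "f' \<in> cls f" shows "f' \<boxtimes> g \<in> cls (f \<boxtimes> g)"
proof -
  obtain h where h: "h \<in> I \<inter> Hom C A B" "f' = h \<boxplus> f" using assms mem_cls by blast
  have "f' \<boxtimes> g = h \<boxtimes> g \<boxplus> f \<boxtimes> g" using h assms TensA_Add_left by auto
  then show ?thesis using clsI[OF TensA_in_Hom[OF assms(1,2)]] Itens(1)[OF h(1) assms(2)] by metis
qed

lemma tens_cls2: assumes "f \<in> Hom C A B" "g \<in> Hom C A' B'" "g' \<in> cls g" shows "f \<boxtimes> g' \<in> cls (f \<boxtimes> g)"
proof -
  obtain h where h: "h \<in> I \<inter> Hom C A' B'" "g' = h \<boxplus> g" using assms mem_cls by blast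
  have "f \<boxtimes> g' = f \<boxtimes> h \<boxplus> f \<boxtimes> g" using h assms TensA_Add_right by auto
  then show ?thesis using clsI[OF TensA_in_Hom[OF assms(1,2)]] Itens(2)[OF h(1) assms(1)] by metis
qed

lemma add_cls: assumes "f \<in> Hom C A B" "g \<in> Hom C A B" "f' \<in> cls f" "g' \<in> cls g" shows "f' \<boxplus> g' \<in> cls (f \<boxplus> g)"
proof -
  obtain h where h: "h \<in> I \<inter> Hom C A B" "f' = h \<boxplus> f" using assms mem_cls by blast
  obtain k where k: "k \<in> I \<inter> Hom C A B" "g' = k \<boxplus> g" using assms mem_cls by blast
  have AB: "A \<in> Ob C" "B \<in> Ob C" using HomD[OF assms(1)] by auto
  interpret comm_group "hom_group C A B" using hom_comm_group AB by blast
  have "f' \<boxplus> g' = (h \<boxplus> k) \<boxplus> (f \<boxplus> g)"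
    using h k assms Add_in_Hom m_lcomm[of f k g] m_assoc[of h f "k \<boxplus> g"] m_assoc[of h k "f \<boxplus> g"]
    by simp
  moreover have "h \<boxplus> k \<in> I \<inter> Hom C A B"
    using subgroup.m_closed[OF subg[OF AB] h(1) k(1)] by simp
  ultimately show ?thesis using clsI[OF Add_in_Hom[OF assms(1,2)]] by metis
qed

lemma UN2: assumes "x0 \<in> X" "y0 \<in> Y" "\<And>x y. x \<in> X \<Longrightarrow> y \<in> Y \<Longrightarrow> F x y = Z"
  shows "(\<Union>x\<in>X. \<Union>y\<in>Y. F x y) = Z"
proof -
  have "(\<Union>x\<in>X. \<Union>y\<in>Y. F x y) = (\<Union>x\<in>X. \<Union>y\<in>Y. Z)" using assms(3) by simp
  also have "\<dots> = Z" using assms(1,2) by blast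
  finally show ?thesis .
qed

lemma Q_Comp: assumes f: "f \<in> Hom C A B" and g: "g \<in> Hom C B D" shows "Comp Q (cls g) (cls f) = cls (g \<cdot> f)"
proof -
  have "cls (g' \<cdot> f') = cls (g \<cdot> f)" if "g' \<in> cls g" "f' \<in> cls f" for g' f'
    using cls_eq[OF Comp_in_Hom[OF f cls_Hom[OF g that(1)]] comp_cls1[OF f cls_Hom[OF g that(1)] that(2)]]
      cls_eq[OF Comp_in_Hom[OF f g] comp_cls2[OF f g that(1)]] by simp
  then have "(\<Union>g' \<in> cls g. \<Union>f' \<in> cls f. cls (g' \<cdot> f')) = cls (g \<cdot> f)"
    by (intro UN2[OF cls_self[OF g] cls_self[OF f]]) auto
  then show ?thesis by (simp add: quotient_category_def)
qed

lemma Q_TensA: assumes f: "f \<in> Hom C A B" and g: "g \<in> Hom C A' B'" shows "TensA Q (cls f) (cls g) = cls (f \<boxtimes> g)"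
proof -
  have "cls (f' \<boxtimes> g') = cls (f \<boxtimes> g)" if "g' \<in> cls g" "f' \<in> cls f" for g' f'
    using cls_eq[OF TensA_in_Hom[OF f cls_Hom[OF g that(1)]] tens_cls1[OF f cls_Hom[OF g that(1)] that(2)]]
      cls_eq[OF TensA_in_Hom[OF f g] tens_cls2[OF f g that(1)]] by simp
  then have "(\<Union>f' \<in> cls f. \<Union>g' \<in> cls g. cls (f' \<boxtimes> g')) = cls (f \<boxtimes> g)"
    by (intro UN2[OF cls_self[OF f] cls_self[OF g]]) auto
  then show ?thesis by (simp add: quotient_category_def)
qed

lemma Q_Add: assumes f: "f \<in> Hom C A B" and g: "g \<in> Hom C A B" shows "Add Q (cls f) (cls g) = cls (f \<boxplus> g)"
proof -
  have "cls (f' \<boxplus> g') = cls (f \<boxplus> g)" if "g' \<in> cls g" "f' \<in> cls f" for g' f'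
    using cls_eq[OF Add_in_Hom[OF f g] add_cls[OF f g that(2,1)]] by simp
  then have "(\<Union>f' \<in> cls f. \<Union>g' \<in> cls g. cls (f' \<boxplus> g')) = cls (f \<boxplus> g)"
    by (intro UN2[OF cls_self[OF f] cls_self[OF g]]) auto
  then show ?thesis by (simp add: quotient_category_def)
qed

lemma Q_sel [simp]:
  "Ob Q = Ob C" "Arr Q = cls ` Arr C" "Id Q A = cls (Id C A)" "Zero Q A B = cls (Zero C A B)"
  "TensO Q = TensO C" "Unit Q = Unit C" "Assoc Q A B D = cls (Assoc C A B D)" "LUnit Q A = cls (LUnit C A)"
  "RUnit Q A = cls (RUnit C A)" "Sym Q A B = cls (Sym C A B)"
  by (simp_all add: quotient_category_def)

lemma Q_Dom: assumes f: "f \<in> Hom C A B" shows "Dom Q (cls f) = A" "Cod Q (cls f) = B"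
proof -
  have "Dom C ` cls f = {A}" "Cod C ` cls f = {B}"
    using cls_self[OF f] cls_Hom[OF f] by (auto simp: Hom_def intro!: image_eqI[where x=f])
  then show "Dom Q (cls f) = A" "Cod Q (cls f) = B" by (simp_all add: quotient_category_def)
qed

lemma Q_Hom: "Hom Q A B = cls ` Hom C A B"
proof -
  have "X \<in> Hom Q A B \<longleftrightarrow> X \<in> cls ` Hom C A B" for X
  proof
    assume "X \<in> Hom Q A B"
    then obtain f where f: "f \<in> Arr C" "X = cls f" "Dom Q X = A" "Cod Q X = B" by (auto simp: Hom_def)
    then have "f \<in> Hom C A B" using Q_Dom[OF ArrD[OF f(1)]] ArrD[OF f(1)] by auto
    then show "X \<in> cls ` Hom C A B" using f by blast
  next
    assume "X \<in> cls ` Hom C A B"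
    then obtain f where f: "f \<in> Hom C A B" "X = cls f" by auto
    then show "X \<in> Hom Q A B" using Q_Dom[OF f(1)] HomD[OF f(1)] unfolding Hom_def[of Q] by simp
  qed
  then show ?thesis by blast
qed

lemma cls_zero_iff: assumes f: "f \<in> Hom C A B" shows "cls f = cls (Zero C A B) \<longleftrightarrow> f \<in> I"
proof -
  have AB: "A \<in> Ob C" "B \<in> Ob C" using HomD[OF f] by auto
  have z: "Zero C A B \<in> Hom C A B" using AB Zero_in_Hom by blast
  have "cls (Zero C A B) = I \<inter> Hom C A B"
    using group.coset_join2[OF grp[OF f] _ subg[OF AB]] subgroup.one_closed[OF subg[OF AB]] z cls_coset[OF z] by auto
  then show ?thesis using f cls_self[OF f] cls_eq[OF z] by blast
qed

lemma Q_hom_group: assumes "A \<in> Ob C" "B \<in> Ob C"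
  shows "comm_group (hom_group Q A B)"
proof -
  interpret G: comm_group "hom_group C A B" using hom_comm_group assms by blast
  have [simp]: "carrier (hom_group Q A B) = cls ` Hom C A B" "mult (hom_group Q A B) = Add Q"
     "one (hom_group Q A B) = cls (Zero C A B)" by (simp_all add: hom_group_def Q_Hom)
  note z = Zero_in_Hom[OF assms]
  show ?thesis
  proof (rule comm_groupI; clarsimp)
    fix x y assume x: "x \<in> Hom C A B" and y: "y \<in> Hom C A B"
    then show "Add Q (cls x) (cls y) \<in> cls ` Hom C A B" using Q_Add Add_in_Hom by auto
    show "Add Q (cls x) (cls y) = Add Q (cls y) (cls x)" using Q_Add[OF x y] Q_Add[OF y x] G.m_comm x y by simp
  next
    show "cls (Zero C A B) \<in> cls ` Hom C A B" using z by blast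
  next
    fix x y w assume "x \<in> Hom C A B" "y \<in> Hom C A B" "w \<in> Hom C A B"
    then show "Add Q (Add Q (cls x) (cls y)) (cls w) = Add Q (cls x) (Add Q (cls y) (cls w))"
      by (simp add: Q_Add[of _ A B] Add_in_Hom Add_assoc[of _ A B])
  next
    fix x assume x: "x \<in> Hom C A B"
    then show "Add Q (cls (Zero C A B)) (cls x) = cls x" by (simp add: Q_Add[of _ A B] z Add_Zero)
    have i: "inv\<^bsub>hom_group C A B\<^esub> x \<in> Hom C A B" "inv\<^bsub>hom_group C A B\<^esub> x \<boxplus> x = Zero C A B"
      using G.inv_closed[of x] G.l_inv[of x] x by auto
    then show "\<exists>y\<in>Hom C A B. Add Q (cls y) (cls x) = cls (Zero C A B)"
      using Q_Add[OF i(1) x] by (intro bexI[of _ "inv\<^bsub>hom_group C A B\<^esub> x"]) auto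
  qed
qed

lemma Q_iso: assumes f: "f \<in> Hom C A B" "iso_arr C f" shows "iso_arr Q (cls f)"
proof -
  have [simp]: "Dom C f = A" "Cod C f = B" using HomD[OF f(1)] by auto
  obtain g where "g \<in> Hom C B A" "g \<cdot> f = Id C A" "f \<cdot> g = Id C B" using f(2) by (auto simp: iso_arr_def)
  then show ?thesis using Q_Dom[OF f(1)] Q_Comp[of f A B g A] Q_Comp[of g B A f B] f HomD[OF f(1)]
    \<open>g \<in> Hom C B A\<close> unfolding iso_arr_def Q_Hom by auto
qed

lemma QE: "X \<in> Hom Q A B \<Longrightarrow> (\<And>f. f \<in> Hom C A B \<Longrightarrow> X = cls f \<Longrightarrow> thesis) \<Longrightarrow> thesis"
  unfolding Q_Hom by blast

lemma QI: "f \<in> Hom C A B \<Longrightarrow> cls f \<in> Hom Q A B"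
  unfolding Q_Hom by blast

lemma Q_cat: "category Q"
proof
  fix X assume "X \<in> Arr Q"
  then obtain f where f: "f \<in> Arr C" "X = cls f" by auto
  show "Dom Q X \<in> Ob Q" "Cod Q X \<in> Ob Q" using Q_Dom[OF ArrD[OF f(1)]] HomD[OF ArrD[OF f(1)]] f(2) by auto
next
  fix A assume "A \<in> Ob Q" then show "Id Q A \<in> Hom Q A A" using QI[OF Id_in_Hom] by simp
next
  fix X A B Y D assume "X \<in> Hom Q A B" "Y \<in> Hom Q B D"
  then obtain f g where fg: "f \<in> Hom C A B" "X = cls f" "g \<in> Hom C B D" "Y = cls g" by (elim QE) blast
  then show "Comp Q Y X \<in> Hom Q A D" using Q_Comp[OF fg(1,3)] QI[OF Comp_in_Hom[OF fg(1,3)]] by simp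
next
  fix X A B assume "X \<in> Hom Q A B"
  then obtain f where fg: "f \<in> Hom C A B" "X = cls f" by (elim QE) blast
  show "Comp Q X (Id Q A) = X" using Q_Comp[OF Id_in_Hom fg(1)] Comp_Id_right[OF fg(1)] fg HomD[OF fg(1)] by simp
  show "Comp Q (Id Q B) X = X" using Q_Comp[OF fg(1) Id_in_Hom] Comp_Id_left[OF fg(1)] fg HomD[OF fg(1)] by simp
next
  fix X A B Y D Z E assume "X \<in> Hom Q A B" "Y \<in> Hom Q B D" "Z \<in> Hom Q D E"
  then obtain f g h where fg: "f \<in> Hom C A B" "X = cls f" "g \<in> Hom C B D" "Y = cls g" "h \<in> Hom C D E" "Z = cls h" by (elim QE) blast
  show "Comp Q (Comp Q Z Y) X = Comp Q Z (Comp Q Y X)" 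
    using Q_Comp[OF fg(1,3)] Q_Comp[OF fg(3,5)] Q_Comp[OF fg(1) Comp_in_Hom[OF fg(3,5)]]
      Q_Comp[OF Comp_in_Hom[OF fg(1,3)] fg(5)] Comp_assoc[OF fg(1,3,5)] fg by simp
qed

lemma Q_add: "additive_category Q"
proof -
  show ?thesis
  proof (intro additive_category.intro additive_category_axioms.intro Q_cat)
    fix A B assume "A \<in> Ob Q" "B \<in> Ob Q" then show "comm_group (hom_group Q A B)" using Q_hom_group by simp
  next
    fix X A B Y D Z assume "X \<in> Hom Q A B" "Y \<in> Hom Q B D" "Z \<in> Hom Q B D"
    then obtain f g h where fg: "f \<in> Hom C A B" "X = cls f" "g \<in> Hom C B D" "Y = cls g" "h \<in> Hom C B D" "Z = cls h" by (elim QE) blast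
    show "Comp Q (Add Q Y Z) X = Add Q (Comp Q Y X) (Comp Q Z X)"
      using Q_Comp[OF fg(1,3)] Q_Comp[OF fg(1,5)] Q_Comp[OF fg(1) Add_in_Hom[OF fg(3,5)]] Q_Add[OF fg(3,5)]
       Q_Add[OF Comp_in_Hom[OF fg(1,3)] Comp_in_Hom[OF fg(1,5)]] Comp_Add_left[OF fg(1,3,5)] fg by simp
  next
    fix X A B Y D Z assume "X \<in> Hom Q A B" "Y \<in> Hom Q A B" "Z \<in> Hom Q B D"
    then obtain f g h where fg: "f \<in> Hom C A B" "X = cls f" "g \<in> Hom C A B" "Y = cls g" "h \<in> Hom C B D" "Z = cls h" by (elim QE) blast
    show "Comp Q Z (Add Q X Y) = Add Q (Comp Q Z X) (Comp Q Z Y)"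
      using Q_Comp[OF fg(1,5)] Q_Comp[OF fg(3,5)] Q_Comp[OF Add_in_Hom[OF fg(1,3)] fg(5)] Q_Add[OF fg(1,3)]
       Q_Add[OF Comp_in_Hom[OF fg(1,5)] Comp_in_Hom[OF fg(3,5)]] Comp_Add_right[OF fg(1,3,5)] fg by simp
  next
    from zero_object obtain Z where Z0: "Z \<in> Ob C" "\<forall>A \<in> Ob C. (\<exists>!f. f \<in> Hom C Z A) \<and> (\<exists>!f. f \<in> Hom C A Z)"
      by (rule bexE)
    note Z = Z0(1) bspec[OF Z0(2)]
    have "(\<exists>!f. f \<in> Hom Q Z A) \<and> (\<exists>!f. f \<in> Hom Q A Z)" if aa: "A \<in> Ob C" for A
    proof -
      have e: "\<exists>x. S = {x}" if "\<exists>!x. x \<in> S" for S :: "'b set" using that by auto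
      obtain f where f: "Hom C Z A = {f}" using e Z(2)[OF aa] by meson
      obtain g where g: "Hom C A Z = {g}" using e Z(2)[OF aa] by meson
      show ?thesis by (simp add: Q_Hom f g)
    qed
    then show "\<exists>Z \<in> Ob Q. \<forall>A \<in> Ob Q. (\<exists>!f. f \<in> Hom Q Z A) \<and> (\<exists>!f. f \<in> Hom Q A Z)" using Z(1) by (intro bexI[of _ Z] ballI) simp_all
  next
    fix A B assume "A \<in> Ob Q" "B \<in> Ob Q"
    then have AB: "A \<in> Ob C" "B \<in> Ob C" by auto
    obtain S i j p q where S: "S \<in> Ob C" "i \<in> Hom C A S" "j \<in> Hom C B S" "p \<in> Hom C S A" "q \<in> Hom C S B"
        "p \<cdot> i = Id C A" "q \<cdot> j = Id C B" "p \<cdot> j = Zero C B A" "q \<cdot> i = Zero C A B" "i \<cdot> p \<boxplus> j \<cdot> q = Id C S"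
      using biproducts[OF AB] by (elim bexE conjE) (rule that; assumption)
    show "\<exists>S \<in> Ob Q. \<exists>i \<in> Hom Q A S. \<exists>j \<in> Hom Q B S. \<exists>p \<in> Hom Q S A. \<exists>q \<in> Hom Q S B.
        Comp Q p i = Id Q A \<and> Comp Q q j = Id Q B \<and> Comp Q p j = Zero Q B A \<and> Comp Q q i = Zero Q A B \<and>
        Add Q (Comp Q i p) (Comp Q j q) = Id Q S"
      apply (rule bexI[of _ S], rule bexI[OF _ QI[OF S(2)]], rule bexI[OF _ QI[OF S(3)]], rule bexI[OF _ QI[OF S(4)]], rule bexI[OF _ QI[OF S(5)]])
      using Q_Comp[OF S(2,4)] Q_Comp[OF S(3,5)] Q_Comp[OF S(3,4)] Q_Comp[OF S(2,5)] Q_Comp[OF S(4,2)] Q_Comp[OF S(5,3)]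
        Q_Add[OF Comp_in_Hom[OF S(4,2)] Comp_in_Hom[OF S(5,3)]] S by simp_all
  qed
qed

lemmas structure_in = Comp_in_Hom TensA_in_Hom Id_in_Hom Assoc_in_Hom LUnit_in_Hom RUnit_in_Hom Sym_in_Hom
   TensO_in_Ob Unit_in_Ob

lemma quotient_tensor_category: "tensor_category Q"
proof -
  show ?thesis
  proof (intro tensor_category.intro tensor_category_axioms.intro Q_add)
    fix A B assume "A \<in> Ob Q" "B \<in> Ob Q"
    then have AB: "A \<in> Ob C" "B \<in> Ob C" by auto
    show "TensO Q A B \<in> Ob Q" using AB TensO_in_Ob by simp
    show "TensA Q (Id Q A) (Id Q B) = Id Q (TensO Q A B)" using Q_TensA[OF Id_in_Hom Id_in_Hom] TensA_Id AB by simp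
    show "Sym Q A B \<in> Hom Q (TensO Q A B) (TensO Q B A)" using QI[OF Sym_in_Hom] AB by simp
    show "Comp Q (Sym Q B A) (Sym Q A B) = Id Q (TensO Q A B)" using Q_Comp[OF Sym_in_Hom Sym_in_Hom] Sym_Sym AB by simp
    have 1: "Id C A \<boxtimes> LUnit C B \<in> Hom C (A \<odot> (Unit C \<odot> B)) (A \<odot> B)"
       "Assoc C A (Unit C) B \<in> Hom C ((A \<odot> Unit C) \<odot> B) (A \<odot> (Unit C \<odot> B))"
      using AB by (auto intro!: structure_in)
    show "Comp Q (TensA Q (Id Q A) (LUnit Q B)) (Assoc Q A (Unit Q) B) = TensA Q (RUnit Q A) (Id Q B)"
      using Q_Comp[OF 1(2,1)] Q_TensA[OF Id_in_Hom[OF AB(1)] LUnit_in_Hom[OF AB(2)]] Q_TensA[OF RUnit_in_Hom[OF AB(1)] Id_in_Hom[OF AB(2)]]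
       triangle[OF AB] by simp
  next
    show "Unit Q \<in> Ob Q" using Unit_in_Ob by simp
  next
    fix X A B Y A' B' assume "X \<in> Hom Q A B" "Y \<in> Hom Q A' B'"
    then obtain f g where fg: "f \<in> Hom C A B" "X = cls f" "g \<in> Hom C A' B'" "Y = cls g" by (elim QE) blast
    then show "TensA Q X Y \<in> Hom Q (TensO Q A A') (TensO Q B B')" using Q_TensA[OF fg(1,3)] QI[OF TensA_in_Hom[OF fg(1,3)]] by simp
    show "Comp Q (Sym Q B B') (TensA Q X Y) = Comp Q (TensA Q Y X) (Sym Q A A')"
      using Q_TensA[OF fg(1,3)] Q_TensA[OF fg(3,1)] Q_Comp[OF Sym_in_Hom TensA_in_Hom[OF fg(3,1)]]
       Q_Comp[OF TensA_in_Hom[OF fg(1,3)] Sym_in_Hom] HomD[OF fg(1)] HomD[OF fg(3)] Sym_natural[OF fg(1,3)] fg by simp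
  next
    fix X A B Y D X' A' B' Y' D' assume "X \<in> Hom Q A B" "Y \<in> Hom Q B D" "X' \<in> Hom Q A' B'" "Y' \<in> Hom Q B' D'"
    then obtain f g f' g' where fg: "f \<in> Hom C A B" "X = cls f" "g \<in> Hom C B D" "Y = cls g" 
      "f' \<in> Hom C A' B'" "X' = cls f'" "g' \<in> Hom C B' D'" "Y' = cls g'" by (elim QE) blast
    show "TensA Q (Comp Q Y X) (Comp Q Y' X') = Comp Q (TensA Q Y Y') (TensA Q X X')"
      using Q_Comp[OF fg(1,3)] Q_Comp[OF fg(5,7)] Q_TensA[OF Comp_in_Hom[OF fg(1,3)] Comp_in_Hom[OF fg(5,7)]]
       Q_TensA[OF fg(1,5)] Q_TensA[OF fg(3,7)] Q_Comp[OF TensA_in_Hom[OF fg(1,5)] TensA_in_Hom[OF fg(3,7)]] TensA_Comp[OF fg(1,3,5,7)] fg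
      by simp
  next
    fix X A B Y Z A' B' assume "X \<in> Hom Q A B" "Y \<in> Hom Q A B" "Z \<in> Hom Q A' B'"
    then obtain f g h where fg: "f \<in> Hom C A B" "X = cls f" "g \<in> Hom C A B" "Y = cls g" "h \<in> Hom C A' B'" "Z = cls h" by (elim QE) blast
    show "TensA Q (Add Q X Y) Z = Add Q (TensA Q X Z) (TensA Q Y Z)"
      using Q_Add[OF fg(1,3)] Q_TensA[OF Add_in_Hom[OF fg(1,3)] fg(5)] Q_TensA[OF fg(1,5)] Q_TensA[OF fg(3,5)]
       Q_Add[OF TensA_in_Hom[OF fg(1,5)] TensA_in_Hom[OF fg(3,5)]] TensA_Add_left[OF fg(1,3,5)] fg by simp
  next
    fix Z A' B' X A B Y assume "Z \<in> Hom Q A' B'" "X \<in> Hom Q A B" "Y \<in> Hom Q A B"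
    then obtain f g h where fg: "f \<in> Hom C A B" "X = cls f" "g \<in> Hom C A B" "Y = cls g" "h \<in> Hom C A' B'" "Z = cls h" by (elim QE) blast
    show "TensA Q Z (Add Q X Y) = Add Q (TensA Q Z X) (TensA Q Z Y)"
      using Q_Add[OF fg(1,3)] Q_TensA[OF fg(5) Add_in_Hom[OF fg(1,3)]] Q_TensA[OF fg(5,1)] Q_TensA[OF fg(5,3)]
       Q_Add[OF TensA_in_Hom[OF fg(5,1)] TensA_in_Hom[OF fg(5,3)]] TensA_Add_right[OF fg(5,1,3)] fg by simp
  next
    fix A B D assume "A \<in> Ob Q" "B \<in> Ob Q" "D \<in> Ob Q"
    then have O: "A \<in> Ob C" "B \<in> Ob C" "D \<in> Ob C" by auto
    show "Assoc Q A B D \<in> Hom Q (TensO Q (TensO Q A B) D) (TensO Q A (TensO Q B D))"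
      using QI[OF Assoc_in_Hom] O by simp
    show "iso_arr Q (Assoc Q A B D)" using Q_iso[OF Assoc_in_Hom Assoc_iso] O by simp
    have a: "Assoc C A B D \<in> Hom C ((A \<odot> B) \<odot> D) (A \<odot> (B \<odot> D))"
       "Sym C A (B \<odot> D) \<in> Hom C (A \<odot> (B \<odot> D)) ((B \<odot> D) \<odot> A)"
       "Assoc C B D A \<in> Hom C ((B \<odot> D) \<odot> A) (B \<odot> (D \<odot> A))"
       "Sym C A B \<boxtimes> Id C D \<in> Hom C ((A \<odot> B) \<odot> D) ((B \<odot> A) \<odot> D)"
       "Assoc C B A D \<in> Hom C ((B \<odot> A) \<odot> D) (B \<odot> (A \<odot> D))"
       "Id C B \<boxtimes> Sym C A D \<in> Hom C (B \<odot> (A \<odot> D)) (B \<odot> (D \<odot> A))"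
      using O by (auto intro!: structure_in)
    show "Comp Q (Assoc Q B D A) (Comp Q (Sym Q A (TensO Q B D)) (Assoc Q A B D)) =
       Comp Q (TensA Q (Id Q B) (Sym Q A D)) (Comp Q (Assoc Q B A D) (TensA Q (Sym Q A B) (Id Q D)))"
      using Q_Comp[OF a(1,2)] Q_Comp[OF Comp_in_Hom[OF a(1,2)] a(3)] Q_Comp[OF a(4,5)] Q_Comp[OF Comp_in_Hom[OF a(4,5)] a(6)]
       Q_TensA[OF Id_in_Hom[OF O(2)] Sym_in_Hom[OF O(1,3)]] Q_TensA[OF Sym_in_Hom[OF O(1,2)] Id_in_Hom[OF O(3)]]
       hexagon[OF O] by simp
  next
    fix X A A' Y B B' Z D D' assume "X \<in> Hom Q A A'" "Y \<in> Hom Q B B'" "Z \<in> Hom Q D D'"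
    then obtain f g h where fg: "f \<in> Hom C A A'" "X = cls f" "g \<in> Hom C B B'" "Y = cls g" "h \<in> Hom C D D'" "Z = cls h" by (elim QE) blast
    note O = HomD[OF fg(1)] HomD[OF fg(3)] HomD[OF fg(5)]
    have a: "Assoc C A B D \<in> Hom C ((A \<odot> B) \<odot> D) (A \<odot> (B \<odot> D))" "Assoc C A' B' D' \<in> Hom C ((A' \<odot> B') \<odot> D') (A' \<odot> (B' \<odot> D'))"
      "f \<boxtimes> g \<in> Hom C (A \<odot> B) (A' \<odot> B')" "g \<boxtimes> h \<in> Hom C (B \<odot> D) (B' \<odot> D')"
      "(f \<boxtimes> g) \<boxtimes> h \<in> Hom C ((A \<odot> B) \<odot> D) ((A' \<odot> B') \<odot> D')" "f \<boxtimes> (g \<boxtimes> h) \<in> Hom C (A \<odot> (B \<odot> D)) (A' \<odot> (B' \<odot> D'))"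
      using O fg by (auto intro!: structure_in)
    show "Comp Q (Assoc Q A' B' D') (TensA Q (TensA Q X Y) Z) = Comp Q (TensA Q X (TensA Q Y Z)) (Assoc Q A B D)"
      using Q_Comp[OF a(5,2)] Q_Comp[OF a(1,6)] Q_TensA[OF fg(1,3)] Q_TensA[OF fg(3,5)] Q_TensA[OF a(3) fg(5)] Q_TensA[OF fg(1) a(4)]
       Assoc_natural[OF fg(1,3,5)] fg by simp
  next
    fix A assume "A \<in> Ob Q" then have O: "A \<in> Ob C" by simp
    show "LUnit Q A \<in> Hom Q (TensO Q (Unit Q) A) A" using QI[OF LUnit_in_Hom] O by simp
    show "RUnit Q A \<in> Hom Q (TensO Q A (Unit Q)) A" using QI[OF RUnit_in_Hom] O by simp
    show "iso_arr Q (LUnit Q A)" using Q_iso[OF LUnit_in_Hom LUnit_iso] O by simp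
    show "iso_arr Q (RUnit Q A)" using Q_iso[OF RUnit_in_Hom RUnit_iso] O by simp
  next
    fix X A B assume "X \<in> Hom Q A B"
    then obtain f where fg: "f \<in> Hom C A B" "X = cls f" by (elim QE) blast
    note O = HomD[OF fg(1)]
    have u: "Id C (Unit C) \<in> Hom C (Unit C) (Unit C)" by (auto intro!: structure_in)
    show "Comp Q (LUnit Q B) (TensA Q (Id Q (Unit Q)) X) = Comp Q X (LUnit Q A)"
      using Q_TensA[OF u fg(1)] Q_Comp[OF TensA_in_Hom[OF u fg(1)] LUnit_in_Hom] Q_Comp[OF LUnit_in_Hom fg(1)] LUnit_natural[OF fg(1)] fg O by simp
    show "Comp Q (RUnit Q B) (TensA Q X (Id Q (Unit Q))) = Comp Q X (RUnit Q A)"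
      using Q_TensA[OF fg(1) u] Q_Comp[OF TensA_in_Hom[OF fg(1) u] RUnit_in_Hom] Q_Comp[OF RUnit_in_Hom fg(1)] RUnit_natural[OF fg(1)] fg O by simp
  next
    fix A B D E assume "A \<in> Ob Q" "B \<in> Ob Q" "D \<in> Ob Q" "E \<in> Ob Q"
    then have O: "A \<in> Ob C" "B \<in> Ob C" "D \<in> Ob C" "E \<in> Ob C" by auto
    have a: "Assoc C (A \<odot> B) D E \<in> Hom C (((A \<odot> B) \<odot> D) \<odot> E) ((A \<odot> B) \<odot> (D \<odot> E))"
      "Assoc C A B (D \<odot> E) \<in> Hom C ((A \<odot> B) \<odot> (D \<odot> E)) (A \<odot> (B \<odot> (D \<odot> E)))"
      "Assoc C A B D \<boxtimes> Id C E \<in> Hom C (((A \<odot> B) \<odot> D) \<odot> E) ((A \<odot> (B \<odot> D)) \<odot> E)"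
      "Assoc C A (B \<odot> D) E \<in> Hom C ((A \<odot> (B \<odot> D)) \<odot> E) (A \<odot> ((B \<odot> D) \<odot> E))"
      "Id C A \<boxtimes> Assoc C B D E \<in> Hom C (A \<odot> ((B \<odot> D) \<odot> E)) (A \<odot> (B \<odot> (D \<odot> E)))"
      using O by (auto intro!: structure_in)
    show "Comp Q (Assoc Q A B (TensO Q D E)) (Assoc Q (TensO Q A B) D E) =
       Comp Q (TensA Q (Id Q A) (Assoc Q B D E)) (Comp Q (Assoc Q A (TensO Q B D) E) (TensA Q (Assoc Q A B D) (Id Q E)))"
      using Q_Comp[OF a(1,2)] Q_Comp[OF a(3,4)] Q_Comp[OF Comp_in_Hom[OF a(3,4)] a(5)] 
       Q_TensA[OF Id_in_Hom[OF O(1)] Assoc_in_Hom[OF O(2-4)]] Q_TensA[OF Assoc_in_Hom[OF O(1-3)] Id_in_Hom[OF O(4)]]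
       pentagon[OF O] by simp
  qed
qed

lemma integral_iff: "integral_category Q \<longleftrightarrow> (\<forall>f \<in> Arr C. \<forall>g \<in> Arr C. f \<boxtimes> g \<in> I \<longrightarrow> f \<in> I \<or> g \<in> I)"
proof -
  have "TensA Q (cls f) (cls g) = Zero Q (TensO Q (Dom Q (cls f)) (Dom Q (cls g))) (TensO Q (Cod Q (cls f)) (Cod Q (cls g))) \<longleftrightarrow> f \<boxtimes> g \<in> I"
    "cls f = Zero Q (Dom Q (cls f)) (Cod Q (cls f)) \<longleftrightarrow> f \<in> I" if "f \<in> Arr C" "g \<in> Arr C" for f g
    using Q_TensA[OF ArrD ArrD, OF that] Q_Dom[OF ArrD[OF that(1)]] Q_Dom[OF ArrD[OF that(2)]] 
      cls_zero_iff[OF ArrD[OF that(1)]] cls_zero_iff[OF TensA_in_Hom[OF ArrD ArrD, OF that]] by simp_all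
  then show ?thesis unfolding integral_category_def Q_sel(2) by auto
qed

end

context tensor_category begin

lemma prime_iff: "prime_tensor_ideal C P \<longleftrightarrow> tensor_ideal C P \<and> P \<noteq> Arr C \<and>
   (\<forall>f \<in> Arr C. \<forall>g \<in> Arr C. f \<boxtimes> g \<in> P \<longrightarrow> f \<in> P \<or> g \<in> P)"
proof (cases "tensor_ideal C P")
  case True
  have L: "tensor_ideal_in C P" by (intro tensor_ideal_in.intro tensor_ideal_in_axioms.intro tensor_category_axioms True)
  show ?thesis unfolding prime_tensor_ideal_def tensor_ideal_in.integral_iff[OF L] ..
qed (simp add: prime_tensor_ideal_def)

lemma idealI: assumes "I \<subseteq> Arr C" "\<And>A B. A \<in> Ob C \<Longrightarrow> B \<in> Ob C \<Longrightarrow> subgroup (I \<inter> Hom C A B) (hom_group C A B)"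
  "\<And>f g. f \<in> I \<Longrightarrow> g \<in> Arr C \<Longrightarrow> Dom C g = Cod C f \<Longrightarrow> g \<cdot> f \<in> I"
  "\<And>f g. f \<in> I \<Longrightarrow> g \<in> Arr C \<Longrightarrow> Cod C g = Dom C f \<Longrightarrow> f \<cdot> g \<in> I"
  "\<And>f g. f \<in> I \<Longrightarrow> g \<in> Arr C \<Longrightarrow> f \<boxtimes> g \<in> I" "\<And>f g. f \<in> I \<Longrightarrow> g \<in> Arr C \<Longrightarrow> g \<boxtimes> f \<in> I"
  shows "tensor_ideal C I"
  unfolding tensor_ideal_def by (intro conjI ballI impI; (rule assms; assumption))

lemma idealD: assumes "tensor_ideal C I" shows "f \<in> I \<Longrightarrow> f \<in> Arr C" "A \<in> Ob C \<Longrightarrow> B \<in> Ob C \<Longrightarrow> subgroup (I \<inter> Hom C A B) (hom_group C A B)"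
  "f \<in> I \<Longrightarrow> g \<in> Arr C \<Longrightarrow> Dom C g = Cod C f \<Longrightarrow> g \<cdot> f \<in> I"
  "f \<in> I \<Longrightarrow> g \<in> Arr C \<Longrightarrow> Cod C g = Dom C f \<Longrightarrow> f \<cdot> g \<in> I"
  "f \<in> I \<Longrightarrow> g \<in> Arr C \<Longrightarrow> f \<boxtimes> g \<in> I" "f \<in> I \<Longrightarrow> g \<in> Arr C \<Longrightarrow> g \<boxtimes> f \<in> I"
proof -
  note 1 = assms[unfolded tensor_ideal_def]
  show "f \<in> I \<Longrightarrow> f \<in> Arr C" using conjunct1[OF 1] by (rule subsetD)
  show "A \<in> Ob C \<Longrightarrow> B \<in> Ob C \<Longrightarrow> subgroup (I \<inter> Hom C A B) (hom_group C A B)" using conjunct1[OF conjunct2[OF 1]] by simp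
  show "f \<in> I \<Longrightarrow> g \<in> Arr C \<Longrightarrow> Dom C g = Cod C f \<Longrightarrow> g \<cdot> f \<in> I" using conjunct1[OF conjunct2[OF conjunct2[OF 1]]] by simp
  show "f \<in> I \<Longrightarrow> g \<in> Arr C \<Longrightarrow> Cod C g = Dom C f \<Longrightarrow> f \<cdot> g \<in> I" using conjunct1[OF conjunct2[OF conjunct2[OF conjunct2[OF 1]]]] by simp
  show "f \<in> I \<Longrightarrow> g \<in> Arr C \<Longrightarrow> f \<boxtimes> g \<in> I" "f \<in> I \<Longrightarrow> g \<in> Arr C \<Longrightarrow> g \<boxtimes> f \<in> I"
    using conjunct2[OF conjunct2[OF conjunct2[OF conjunct2[OF 1]]]] by simp_all
qed

lemma Inter_ideal: assumes "\<I> \<noteq> {}" "\<And>I. I \<in> \<I> \<Longrightarrow> tensor_ideal C I" shows "tensor_ideal C (\<Inter>\<I>)"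
proof -
  have "subgroup (\<Inter>\<I> \<inter> Hom C A B) (hom_group C A B)" if "A \<in> Ob C" "B \<in> Ob C" for A B
  proof -
    interpret comm_group "hom_group C A B" using hom_comm_group that by blast
    have "subgroup (\<Inter>((\<lambda>I. I \<inter> Hom C A B) ` \<I>)) (hom_group C A B)"
      by (rule subgroups_Inter) (use assms(1) idealD(2)[OF assms(2) that] in auto)
    moreover have "\<Inter>((\<lambda>I. I \<inter> Hom C A B) ` \<I>) = \<Inter>\<I> \<inter> Hom C A B" using assms(1) by auto
    ultimately show ?thesis by simp
  qed
  moreover have "\<Inter>\<I> \<subseteq> Arr C"
  proof -
    obtain I where "I \<in> \<I>" using assms(1) by blast
    then show ?thesis using idealD(1)[OF assms(2)] by blast
  qed
  ultimately show ?thesis using idealD(3-6)[OF assms(2)] by (intro idealI) simp_all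
qed

lemma Arr_ideal: "tensor_ideal C (Arr C)"
proof -
  have "Arr C \<inter> Hom C A B = Hom C A B" for A B by (auto simp: Hom_def)
  moreover have "subgroup (Hom C A B) (hom_group C A B)" if "A \<in> Ob C" "B \<in> Ob C" for A B
    using group.subgroup_self[of "hom_group C A B"] hom_comm_group[OF that] comm_group_def by auto
  moreover have "f \<boxtimes> g \<in> Arr C" if "f \<in> Arr C" "g \<in> Arr C" for f g
    using HomD[OF TensA_in_Hom[OF ArrD ArrD, OF that]] by blast
  moreover have "g \<cdot> f \<in> Arr C" if "f \<in> Arr C" "g \<in> Arr C" "Dom C g = Cod C f" for f g
    using HomD[OF Comp_in_Hom[of f "Dom C f" "Cod C f" g "Cod C g"]] that by (auto simp: Hom_def)
  ultimately show ?thesis by (intro idealI) simp_all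
qed

definition "zeros = {Zero C A B | A B. A \<in> Ob C \<and> B \<in> Ob C}"

lemma zeros_ideal: "tensor_ideal C zeros"
proof -
  have mem: "f \<in> zeros" if f: "f \<in> Hom C A B" and "f \<boxplus> f = f" for f A B
    using idem_Zero[OF that] HomD[OF f] by (auto simp: zeros_def)
  have z: "Zero C A B \<boxplus> Zero C A B = Zero C A B" if "A \<in> Ob C" "B \<in> Ob C" for A B
    using Add_Zero Zero_in_Hom that by blast
  have D: "f \<in> Hom C (Dom C f) (Cod C f) \<and> f \<boxplus> f = f \<and> f \<in> Arr C" if "f \<in> zeros" for f
  proof -
    obtain A B where A: "A \<in> Ob C" "B \<in> Ob C" "f = Zero C A B" using \<open>f \<in> zeros\<close> by (auto simp: zeros_def)
    show ?thesis using HomD[OF Zero_in_Hom[OF A(1,2)]] z[OF A(1,2)] Zero_in_Hom[OF A(1,2)] A(3) by simp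
  qed
  have 1: "zeros \<inter> Hom C A B = {Zero C A B}" if AB: "A \<in> Ob C" "B \<in> Ob C" for A B
  proof -
    have "f = Zero C A B" if f: "f \<in> zeros" "f \<in> Hom C A B" for f using idem_Zero[OF f(2)] D[OF f(1)] by blast
    moreover have "Zero C A B \<in> zeros" using AB by (auto simp: zeros_def)
    ultimately show ?thesis using Zero_in_Hom[OF AB] by blast
  qed
  have 2: "subgroup (zeros \<inter> Hom C A B) (hom_group C A B)" if "A \<in> Ob C" "B \<in> Ob C" for A B
  proof -
    interpret comm_group "hom_group C A B" using hom_comm_group that by blast
    show ?thesis using triv_subgroup 1[OF that] by simp
  qed
  have 3: "g \<cdot> f \<in> zeros" if f: "f \<in> zeros" and g: "g \<in> Arr C" "Dom C g = Cod C f" for f g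
  proof (rule mem)
    have g: "g \<in> Hom C (Cod C f) (Cod C g)" using g by (simp add: Hom_def)
    have f': "f \<in> Hom C (Dom C f) (Cod C f)" using D f by blast
    show "g \<cdot> f \<in> Hom C (Dom C f) (Cod C g)" using Comp_in_Hom[OF f' g] .
    show "g \<cdot> f \<boxplus> g \<cdot> f = g \<cdot> f" using Comp_Add_right[OF f' f' g] D f by simp
  qed
  have 4: "f \<cdot> g \<in> zeros" if f: "f \<in> zeros" and g: "g \<in> Arr C" "Cod C g = Dom C f" for f g
  proof (rule mem)
    have g: "g \<in> Hom C (Dom C g) (Dom C f)" using g by (simp add: Hom_def)
    have f': "f \<in> Hom C (Dom C f) (Cod C f)" using D f by blast
    show "f \<cdot> g \<in> Hom C (Dom C g) (Cod C f)" using Comp_in_Hom[OF g f'] .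
    show "f \<cdot> g \<boxplus> f \<cdot> g = f \<cdot> g" using Comp_Add_left[OF g f' f'] D f by simp
  qed
  have 5: "f \<boxtimes> g \<in> zeros" "g \<boxtimes> f \<in> zeros" if f: "f \<in> zeros" and g: "g \<in> Arr C" for f g
  proof -
    have f': "f \<in> Hom C (Dom C f) (Cod C f)" using D f by blast
    show "f \<boxtimes> g \<in> zeros" using mem[OF TensA_in_Hom[OF f' ArrD[OF g]]] TensA_Add_left[OF f' f' ArrD[OF g]] D f by simp
    show "g \<boxtimes> f \<in> zeros" using mem[OF TensA_in_Hom[OF ArrD[OF g] f']] TensA_Add_right[OF ArrD[OF g] f' f'] D f by simp
  qed
  have "zeros \<subseteq> Arr C" using D by blast
  then show ?thesis using 2 3 4 5 by (intro idealI) simp_all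
qed

lemma zeros_le: "tensor_ideal C I \<Longrightarrow> zeros \<subseteq> I"
  using subgroup.one_closed[OF idealD(2), of I] by (auto simp: zeros_def)

lemma istopology_Spec: "istopology (\<lambda>U. \<exists>I. tensor_ideal C I \<and> U = tensor_primes C - vanishing C I)"
  unfolding istopology_def
proof safe
  fix I J assume I: "tensor_ideal C I" and J: "tensor_ideal C J"
  have "P \<in> vanishing C I \<union> vanishing C J" if "P \<in> vanishing C (I \<inter> J)" for P
  proof (rule ccontr)
    have P: "prime_tensor_ideal C P" "I \<inter> J \<subseteq> P" using that by (auto simp: vanishing_def tensor_primes_def)
    assume "P \<notin> vanishing C I \<union> vanishing C J"
    then obtain f g where "f \<in> I" "f \<notin> P" "g \<in> J" "g \<notin> P" using P(1) unfolding vanishing_def tensor_primes_def by blast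
    moreover have "f \<in> Arr C" "g \<in> Arr C" using I J calculation by (auto simp: tensor_ideal_def)
    moreover have "f \<boxtimes> g \<in> I \<inter> J" using I J calculation by (auto simp: tensor_ideal_def)
    ultimately show False using P unfolding prime_iff by blast
  qed
  then have "vanishing C (I \<inter> J) = vanishing C I \<union> vanishing C J" by (auto simp: vanishing_def)
  moreover have "tensor_ideal C (I \<inter> J)" using Inter_ideal[of "{I,J}"] I J by auto
  ultimately show "\<exists>K. tensor_ideal C K \<and> (tensor_primes C - vanishing C I) \<inter> (tensor_primes C - vanishing C J) = tensor_primes C - vanishing C K"
    by blast
next
  fix \<K> assume "\<forall>K\<in>\<K>. \<exists>I. tensor_ideal C I \<and> K = tensor_primes C - vanishing C I"
  then obtain i where ii: "\<forall>K\<in>\<K>. tensor_ideal C (i K) \<and> K = tensor_primes C - vanishing C (i K)" by metis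
  then have i1: "\<And>K. K \<in> \<K> \<Longrightarrow> tensor_ideal C (i K)" by blast
  from ii have i2: "\<Union>\<K> = (\<Union>K\<in>\<K>. tensor_primes C - vanishing C (i K))" by blast
  define J where "J = \<Inter>{J. tensor_ideal C J \<and> \<Union>(i ` \<K>) \<subseteq> J}"
  have "Arr C \<in> {J. tensor_ideal C J \<and> \<Union>(i ` \<K>) \<subseteq> J}"
    using Arr_ideal idealD(1)[OF i1] by auto
  then have J: "tensor_ideal C J" unfolding J_def
    by (intro Inter_ideal) auto
  have "vanishing C J = {P \<in> tensor_primes C. \<Union>(i ` \<K>) \<subseteq> P}"
  proof -
    have 1: "\<Union>(i ` \<K>) \<subseteq> J" unfolding J_def by blast
    have 2: "J \<subseteq> P" if "tensor_ideal C P" "\<Union>(i ` \<K>) \<subseteq> P" for P using that unfolding J_def by blast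
    show ?thesis unfolding vanishing_def tensor_primes_def prime_tensor_ideal_def using 1 2 by blast
  qed
  then have "\<Union>\<K> = tensor_primes C - vanishing C J" unfolding i2 by (auto simp: vanishing_def)
  then show "\<exists>I. tensor_ideal C I \<and> \<Union>\<K> = tensor_primes C - vanishing C I" using J by blast
qed

lemma openin_Spec: "openin (tensor_Spec C) U \<longleftrightarrow> (\<exists>I. tensor_ideal C I \<and> U = tensor_primes C - vanishing C I)"
  unfolding tensor_Spec_def by (simp add: topology_inverse'[OF istopology_Spec])

lemma topspace_Spec: "topspace (tensor_Spec C) = tensor_primes C"
proof -
  have "vanishing C (Arr C) = {}" by (auto simp: vanishing_def tensor_primes_def prime_tensor_ideal_def tensor_ideal_def)
  then have "openin (tensor_Spec C) (tensor_primes C)" using Arr_ideal openin_Spec by auto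
  then show ?thesis using openin_Spec openin_subset openin_topspace by (metis Diff_subset subset_antisym)
qed

lemma closedin_Spec: "closedin (tensor_Spec C) Z \<longleftrightarrow> (\<exists>I. tensor_ideal C I \<and> Z = vanishing C I)"
proof -
  have s: "vanishing C I \<subseteq> tensor_primes C" for I by (auto simp: vanishing_def)
  show ?thesis unfolding closedin_def openin_Spec topspace_Spec
    using s by (metis double_diff Diff_Diff_Int inf.absorb_iff2 order_refl)
qed

end

end

theory Submission
  imports Defs "HOL-Analysis.Function_Topology"
begin

text \<open>
  An arrow set is a point of the Cantor cube of all predicates on arrows, and by the elementwise
  description of primality the prime tensor ideals form a closed, hence compact, subset of it:
  every condition involves only finitely many arrows at a time, properness being the condition that
  the identity of the unit object is excluded. As this constructible topology is finer than the
  topology of the spectrum, all basic open sets \<open>D(f) = {P. f \<notin> P}\<close> are quasi-compact. They form a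
  basis with \<open>D(f) \<inter> D(g) = D(f \<otimes> g)\<close>, and the preimage of \<open>D(f)\<close> under \<open>F\<^sup>*\<close> is \<open>D(F f)\<close>. The
  generic point of an irreducible closed set is the intersection of its elements.
\<close>

section \<open>Spectral spaces from a basis of quasi-compact open sets\<close>

text \<open>Quasi-compactness is applied to the cover of \<open>U\<close> by those members of
  \<open>\<B>\<close> that lie inside \<open>U\<close>, so that the finite subcover cannot
  overshoot. Both intersections and preimages of quasi-compact open sets are reduced to basic ones
  this way.\<close>

lemma compactin_openin_finite_union:
  assumes "openin X U" "compactin X U"
    and open_basis: "\<And>B. B \<in> \<B> \<Longrightarrow> openin X B"
    and basis: "\<And>x. x \<in> U \<Longrightarrow> \<exists>B \<in> \<B>. x \<in> B \<and> B \<subseteq> U"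
  shows "\<exists>\<F>. finite \<F> \<and> \<F> \<subseteq> \<B> \<and> U = \<Union>\<F>"
proof -
  have "U \<subseteq> \<Union>{B \<in> \<B>. B \<subseteq> U}"
    using basis by blast
  then obtain \<F> where "finite \<F>" "\<F> \<subseteq> {B \<in> \<B>. B \<subseteq> U}" "U \<subseteq> \<Union>\<F>"
    using compactinD[OF assms(2), of "{B \<in> \<B>. B \<subseteq> U}"] open_basis by auto
  then show ?thesis
    by (intro exI[of _ \<F>]) auto
qed

text \<open>Intersection distributes over the two finite unions of basis members, so only pairwise
  intersections within the basis have to be quasi-compact.\<close>

lemma compactin_Int_of_basis:
  assumes "openin X U" "compactin X U" "openin X V" "compactin X V"
    and open_basis: "\<And>B. B \<in> \<B> \<Longrightarrow> openin X B"
    and basis: "\<And>W x. openin X W \<Longrightarrow> x \<in> W \<Longrightarrow> \<exists>B \<in> \<B>. x \<in> B \<and> B \<subseteq> W"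
    and Int: "\<And>A B. A \<in> \<B> \<Longrightarrow> B \<in> \<B> \<Longrightarrow> compactin X (A \<inter> B)"
  shows "compactin X (U \<inter> V)"
proof -
  obtain \<F> where F: "finite \<F>" "\<F> \<subseteq> \<B>" "U = \<Union>\<F>"
    using compactin_openin_finite_union[OF assms(1,2) open_basis basis[OF assms(1)]] by blast
  obtain \<G> where G: "finite \<G>" "\<G> \<subseteq> \<B>" "V = \<Union>\<G>"
    using compactin_openin_finite_union[OF assms(3,4) open_basis basis[OF assms(3)]] by blast
  have "U \<inter> V = \<Union>((\<lambda>(A, B). A \<inter> B) ` (\<F> \<times> \<G>))"
    using F G by auto
  moreover have "compactin X (\<Union>((\<lambda>(A, B). A \<inter> B) ` (\<F> \<times> \<G>)))"
    using F G Int by (intro compactin_Union) auto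
  ultimately show ?thesis
    by simp
qed

section \<open>The cube of predicates\<close>

text \<open>Evaluation at \<open>f\<close> is continuous into the discrete space
  \<open>bool\<close>, so both of its fibres are open; each is the complement of the other.\<close>

lemma open_coordinate: "open {\<phi>. \<phi> f}"
  and closed_coordinate: "closed {\<phi>. \<phi> f}" for f :: 'a
proof -
  have c: "continuous_on UNIV (\<lambda>\<phi> :: 'a \<Rightarrow> bool. \<phi> f)"
    by (rule continuous_on_product_coordinates)
  have "open {\<phi>. \<phi> f = b}" for b :: bool
    using open_vimage[OF open_discrete c, of "{b}"] by (simp add: vimage_def)
  from this[of True] this[of False] show "open {\<phi>. \<phi> f}" "closed {\<phi>. \<phi> f}"
    by (simp_all add: closed_def Compl_eq)
qed

text \<open>Tychonoff's theorem for two-point factors.\<close>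

lemma compact_bool_cube: "compact (UNIV :: ('a \<Rightarrow> bool) set)"
proof -
  have "compact_space (product_topology (\<lambda>_ :: 'a. euclidean :: bool topology) UNIV)"
    by (intro iffD2[OF compact_space_product_topology] disjI2 ballI) (simp add: compact_space_def finite_imp_compact)
  then show ?thesis
    by (simp add: euclidean_product_topology compact_space_def)
qed

section \<open>Elementwise characterization of tensor ideals\<close>

context tensor_category
begin

text \<open>Closure under negation is not listed, since \<open>- f = (- id) \<cdot> f\<close>.\<close>

lemma tensor_ideal_iff:
  "tensor_ideal C I \<longleftrightarrow> I \<subseteq> Arr C \<and>
     (\<forall>A B. A \<in> Ob C \<and> B \<in> Ob C \<longrightarrow> Zero C A B \<in> I) \<and>
     (\<forall>f g A B. f \<in> Hom C A B \<and> g \<in> Hom C A B \<longrightarrow> f \<in> I \<longrightarrow> g \<in> I \<longrightarrow> f \<boxplus> g \<in> I) \<and>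
     (\<forall>f g. g \<in> Arr C \<and> Dom C g = Cod C f \<longrightarrow> f \<in> I \<longrightarrow> g \<cdot> f \<in> I) \<and>
     (\<forall>f g. g \<in> Arr C \<and> Cod C g = Dom C f \<longrightarrow> f \<in> I \<longrightarrow> f \<cdot> g \<in> I) \<and>
     (\<forall>f g. g \<in> Arr C \<longrightarrow> f \<in> I \<longrightarrow> f \<boxtimes> g \<in> I) \<and>
     (\<forall>f g. g \<in> Arr C \<longrightarrow> f \<in> I \<longrightarrow> g \<boxtimes> f \<in> I)"
  (is "_ \<longleftrightarrow> ?rhs")
proof
  assume I: "tensor_ideal C I"
  have "Zero C A B \<in> I" if "A \<in> Ob C" "B \<in> Ob C" for A B
    using subgroup.one_closed[OF idealD(2)[OF I that]] by simp
  moreover have "f \<boxplus> g \<in> I" if "f \<in> Hom C A B" "g \<in> Hom C A B" "f \<in> I" "g \<in> I" for f g A B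
    using subgroup.m_closed[OF idealD(2)[OF I], of A B f g] HomD[OF that(1)] that by simp
  ultimately show ?rhs
    using idealD(1,3-6)[OF I] by (intro conjI allI impI subsetI; (elim conjE)?) simp_all
next
  assume ?rhs
  then have r: "I \<subseteq> Arr C" "\<And>A B. A \<in> Ob C \<Longrightarrow> B \<in> Ob C \<Longrightarrow> Zero C A B \<in> I"
    "\<And>f g A B. f \<in> Hom C A B \<Longrightarrow> g \<in> Hom C A B \<Longrightarrow> f \<in> I \<Longrightarrow> g \<in> I \<Longrightarrow> f \<boxplus> g \<in> I"
    "\<And>f g. f \<in> I \<Longrightarrow> g \<in> Arr C \<Longrightarrow> Dom C g = Cod C f \<Longrightarrow> g \<cdot> f \<in> I"
    "\<And>f g. f \<in> I \<Longrightarrow> g \<in> Arr C \<Longrightarrow> Cod C g = Dom C f \<Longrightarrow> f \<cdot> g \<in> I"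
    "\<And>f g. f \<in> I \<Longrightarrow> g \<in> Arr C \<Longrightarrow> f \<boxtimes> g \<in> I"
    "\<And>f g. f \<in> I \<Longrightarrow> g \<in> Arr C \<Longrightarrow> g \<boxtimes> f \<in> I"
    by blast+
  show "tensor_ideal C I"
  proof (rule idealI)
    fix A B assume AB: "A \<in> Ob C" "B \<in> Ob C"
    interpret comm_group "hom_group C A B"
      using hom_comm_group[OF AB] .
    interpret E: comm_group "hom_group C B B"
      using hom_comm_group[OF AB(2,2)] .
    define n where "n = inv\<^bsub>hom_group C B B\<^esub> (Id C B)"
    have n: "n \<in> Hom C B B" "n \<boxplus> Id C B = Zero C B B"
      using E.inv_closed[of "Id C B"] E.l_inv[of "Id C B"] Id_in_Hom[OF AB(2)]
      by (auto simp: n_def)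
    have inv: "inv\<^bsub>hom_group C A B\<^esub> f = n \<cdot> f" if f: "f \<in> Hom C A B" for f
    proof -
      have z: "Zero C B B \<in> Hom C B B"
        using Zero_in_Hom AB by blast
      \<comment> \<open>A composite with a zero arrow is idempotent under addition, and the only
        such element of a group is its neutral element.\<close>
      have "Zero C B B \<cdot> f \<boxplus> Zero C B B \<cdot> f = Zero C B B \<cdot> f"
        using Comp_Add_left[OF f z z] Add_Zero[OF z] by simp
      then have "Zero C B B \<cdot> f = Zero C A B"
        using idem_Zero[OF Comp_in_Hom[OF f z]] by blast
      then have "n \<cdot> f \<boxplus> f = Zero C A B"
        using Comp_Add_left[OF f n(1) Id_in_Hom[OF AB(2)]] Comp_Id_left[OF f] n(2) by simp
      then show ?thesis
        using inv_equality[of "n \<cdot> f" f] f Comp_in_Hom[OF f n(1)] by simp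
    qed
    show "subgroup (I \<inter> Hom C A B) (hom_group C A B)"
    proof (rule subgroupI)
      show "I \<inter> Hom C A B \<noteq> {}"
        using r(2)[OF AB] Zero_in_Hom[OF AB] by blast
    next
      fix f assume f: "f \<in> I \<inter> Hom C A B"
      then have "n \<cdot> f \<in> I"
        using r(4)[of f n] HomD[OF n(1)] HomD[of f A B] by simp
      then show "inv\<^bsub>hom_group C A B\<^esub> f \<in> I \<inter> Hom C A B"
        using inv[of f] f Comp_in_Hom[OF _ n(1), of f] by auto
    next
      fix f g assume "f \<in> I \<inter> Hom C A B" "g \<in> I \<inter> Hom C A B"
      then show "f \<otimes>\<^bsub>hom_group C A B\<^esub> g \<in> I \<inter> Hom C A B"
        using r(3)[of f A B g] Add_in_Hom[of f A B g] by simp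
    qed auto
  qed (fact r)+
qed

text \<open>Tensoring with the identity of \<open>A\<close> puts the identity of
  \<open>A \<odot> Unit C\<close> into the ideal; conjugating by the right unit constraint gives the
  identity of \<open>A\<close>, through which every arrow out of \<open>A\<close> factors.\<close>

lemma Id_Unit_in_ideal:
  assumes I: "tensor_ideal C I" and u: "Id C (Unit C) \<in> I"
  shows "I = Arr C"
proof -
  have "f \<in> I" if "f \<in> Arr C" for f
  proof -
    define A where "A = Dom C f"
    have f: "f \<in> Hom C A (Cod C f)" and A: "A \<in> Ob C"
      using ArrD[OF that] dom_in_Ob[OF that] by (auto simp: A_def)
    \<comment> \<open>With \<open>s\<close> inverse to the constraint, \<open>Id C A\<close> is
      \<open>RUnit C A \<cdot> Id C (A \<odot> Unit C) \<cdot> s\<close>.\<close>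
    note r = HomD[OF RUnit_in_Hom[OF A]]
    obtain s where s: "s \<in> Hom C A (A \<odot> Unit C)" "RUnit C A \<cdot> s = Id C A"
      using RUnit_iso[OF A] r by (auto simp: iso_arr_def)
    have "Id C A \<boxtimes> Id C (Unit C) \<in> I"
      using idealD(6)[OF I u] HomD[OF Id_in_Hom[OF A]] by blast
    then have i: "Id C (A \<odot> Unit C) \<in> I"
      using TensA_Id[OF A Unit_in_Ob] by simp
    have "RUnit C A \<cdot> Id C (A \<odot> Unit C) \<in> I"
      using idealD(3)[OF I i, of "RUnit C A"] r HomD[OF Id_in_Hom[OF TensO_in_Ob[OF A Unit_in_Ob]]] by simp
    then have "RUnit C A \<in> I"
      using Comp_Id_right[OF RUnit_in_Hom[OF A]] by simp
    then have "RUnit C A \<cdot> s \<in> I"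
      using idealD(4)[OF I, of "RUnit C A" s] r HomD[OF s(1)] by simp
    then have "Id C A \<in> I"
      using s(2) by simp
    then have "f \<cdot> Id C A \<in> I"
      using idealD(3)[OF I, of "Id C A" f] HomD[OF f] HomD[OF Id_in_Hom[OF A]] by simp
    then show ?thesis
      using Comp_Id_right[OF f] by simp
  qed
  then show ?thesis
    using idealD(1)[OF I] by blast
qed

text \<open>Properness by itself only says that some arrow is missing, which need not be a closed
  condition on the cube. Naming the missing arrow turns it into a condition on a single
  coordinate.\<close>

lemma prime_proper_iff:
  "tensor_ideal C I \<Longrightarrow> I \<noteq> Arr C \<longleftrightarrow> Id C (Unit C) \<notin> I"
  using Id_Unit_in_ideal HomD[OF Id_in_Hom[OF Unit_in_Ob]] by blast

text \<open>In the equivalence, primality gives one direction and stability under tensoring with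
  arbitrary arrows the other.\<close>

lemma tensor_primesD:
  assumes "P \<in> tensor_primes C"
  shows "tensor_ideal C P" "Id C (Unit C) \<notin> P"
    "f \<in> Arr C \<Longrightarrow> g \<in> Arr C \<Longrightarrow> f \<boxtimes> g \<in> P \<longleftrightarrow> f \<in> P \<or> g \<in> P"
proof -
  have P: "tensor_ideal C P" "P \<noteq> Arr C"
    "\<And>f g. f \<in> Arr C \<Longrightarrow> g \<in> Arr C \<Longrightarrow> f \<boxtimes> g \<in> P \<Longrightarrow> f \<in> P \<or> g \<in> P"
    using assms by (simp_all add: tensor_primes_def prime_iff)
  show "tensor_ideal C P" "Id C (Unit C) \<notin> P"
    using P(1,2) prime_proper_iff by simp_all
  show "f \<boxtimes> g \<in> P \<longleftrightarrow> f \<in> P \<or> g \<in> P" if "f \<in> Arr C" "g \<in> Arr C"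
    using P(3)[OF that] idealD(5)[OF P(1) _ that(2)] idealD(6)[OF P(1) _ that(1)] by blast
qed

section \<open>The constructible topology\<close>

text \<open>The analogue of the distinguished open sets of a Zariski spectrum. If \<open>f\<close>
  is not an arrow, this is the whole spectrum, since primes consist of arrows.\<close>

definition basic_open :: "'b \<Rightarrow> 'b set set" where
  "basic_open f = {P \<in> tensor_primes C. f \<notin> P}"

lemma closed_primes: "closed {\<phi>. Collect \<phi> \<in> tensor_primes C}"
proof -
  \<comment> \<open>Side conditions free of \<open>\<phi>\<close> are kept apart as outer premises:
    they are constant on the cube, while every other atom is a coordinate condition.\<close>
  have "Collect \<phi> \<in> tensor_primes C \<longleftrightarrow>
     (\<forall>f. \<phi> f \<longrightarrow> f \<in> Arr C) \<and>
     (\<forall>A B. A \<in> Ob C \<and> B \<in> Ob C \<longrightarrow> \<phi> (Zero C A B)) \<and>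
     (\<forall>f g A B. f \<in> Hom C A B \<and> g \<in> Hom C A B \<longrightarrow> \<phi> f \<longrightarrow> \<phi> g \<longrightarrow> \<phi> (f \<boxplus> g)) \<and>
     (\<forall>f g. g \<in> Arr C \<and> Dom C g = Cod C f \<longrightarrow> \<phi> f \<longrightarrow> \<phi> (g \<cdot> f)) \<and>
     (\<forall>f g. g \<in> Arr C \<and> Cod C g = Dom C f \<longrightarrow> \<phi> f \<longrightarrow> \<phi> (f \<cdot> g)) \<and>
     (\<forall>f g. g \<in> Arr C \<longrightarrow> \<phi> f \<longrightarrow> \<phi> (f \<boxtimes> g)) \<and>
     (\<forall>f g. g \<in> Arr C \<longrightarrow> \<phi> f \<longrightarrow> \<phi> (g \<boxtimes> f)) \<and>
     \<not> \<phi> (Id C (Unit C)) \<and>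
     (\<forall>f g. f \<in> Arr C \<and> g \<in> Arr C \<longrightarrow> \<phi> (f \<boxtimes> g) \<longrightarrow> \<phi> f \<or> \<phi> g)" (is "_ \<longleftrightarrow> ?rhs \<phi>") for \<phi>
  proof -
    have "Collect \<phi> \<in> tensor_primes C \<longleftrightarrow> tensor_ideal C (Collect \<phi>) \<and> \<not> \<phi> (Id C (Unit C)) \<and>
        (\<forall>f g. f \<in> Arr C \<and> g \<in> Arr C \<longrightarrow> \<phi> (f \<boxtimes> g) \<longrightarrow> \<phi> f \<or> \<phi> g)"
      using prime_proper_iff[of "Collect \<phi>"] by (auto simp: tensor_primes_def prime_iff)
    then show ?thesis
      by (simp only: tensor_ideal_iff subset_iff mem_Collect_eq conj_assoc)
  qed
  then have "{\<phi>. Collect \<phi> \<in> tensor_primes C} = {\<phi>. ?rhs \<phi>}"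
    by simp
  \<comment> \<open>An implication is closed when its premise is open and its conclusion closed.
    Coordinate conditions are both, and universal quantifiers are intersections of closed
    sets.\<close>
  moreover have "closed {\<phi>. ?rhs \<phi>}"
    by (intro closed_Collect_conj closed_Collect_all closed_Collect_imp closed_Collect_neg
        closed_Collect_disj open_Collect_const closed_Collect_const open_coordinate closed_coordinate)
  ultimately show ?thesis
    by simp
qed

section \<open>The spectrum is spectral\<close>

text \<open>A prime misses some element of \<open>S\<close> exactly when it fails to contain the
  tensor ideal \<open>J\<close> generated by \<open>S\<close>.\<close>

lemma openin_basic_union: "S \<subseteq> Arr C \<Longrightarrow> openin (tensor_Spec C) (\<Union>(basic_open ` S))"
proof -
  assume S: "S \<subseteq> Arr C"
  define J where "J = \<Inter>{J. tensor_ideal C J \<and> S \<subseteq> J}"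
  have "tensor_ideal C J"
    \<comment> \<open>The intersected family is nonempty because it contains
      \<open>Arr C\<close>.\<close>
    unfolding J_def using S Arr_ideal by (intro Inter_ideal) auto
  moreover have "J \<subseteq> P \<longleftrightarrow> S \<subseteq> P" if "P \<in> tensor_primes C" for P
    using tensor_primesD(1)[OF that] unfolding J_def by blast
  then have "\<Union>(basic_open ` S) = tensor_primes C - vanishing C J"
    by (auto simp: basic_open_def vanishing_def)
  ultimately show ?thesis
    unfolding openin_Spec by blast
qed

lemma openin_basic_open: "f \<in> Arr C \<Longrightarrow> openin (tensor_Spec C) (basic_open f)"
  using openin_basic_union[of "{f}"] by simp

text \<open>If \<open>U\<close> is the complement of \<open>vanishing C I\<close>, any
  \<open>f\<close> in \<open>I\<close> outside \<open>P\<close> serves: a prime missing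
  \<open>f\<close> cannot contain \<open>I\<close>.\<close>

lemma basic_open_basis:
  assumes "openin (tensor_Spec C) U" "P \<in> U"
  shows "\<exists>B \<in> basic_open ` Arr C. P \<in> B \<and> B \<subseteq> U"
proof -
  obtain I where "tensor_ideal C I" "U = tensor_primes C - vanishing C I"
    using assms(1) openin_Spec by blast
  then show ?thesis
    using assms(2) idealD(1) by (force simp: basic_open_def vanishing_def)
qed

text \<open>The set is the image under \<open>Collect\<close> of a closed, hence compact, subset of
  the cube, and \<open>Collect\<close> is continuous because the constructible topology refines that
  of the spectrum.\<close>

lemma compactin_basic_open: "compactin (tensor_Spec C) (basic_open f)"
proof -
  define K where "K = {\<phi>. Collect \<phi> \<in> tensor_primes C}"
  have "continuous_map (top_of_set K) (tensor_Spec C) Collect"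
    unfolding continuous_map_def
  proof (intro conjI allI impI)
    fix U assume "openin (tensor_Spec C) U"
    then obtain I where "U = tensor_primes C - vanishing C I"
      using openin_Spec by blast
    \<comment> \<open>Not containing \<open>I\<close> means missing at least one of its arrows,
      which is a union of open coordinate conditions.\<close>
    then have "{\<phi> \<in> topspace (top_of_set K). Collect \<phi> \<in> U} = K \<inter> (\<Union>f \<in> I. {\<phi>. \<not> \<phi> f})"
      by (auto simp: K_def vanishing_def)
    moreover have "open (\<Union>f \<in> I. {\<phi>. \<not> \<phi> f})"
      by (intro open_UN ballI open_Collect_neg closed_coordinate)
    ultimately show "openin (top_of_set K) {\<phi> \<in> topspace (top_of_set K). Collect \<phi> \<in> U}"
      by (simp add: openin_open_Int)
  qed (simp add: K_def topspace_Spec)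
  moreover have "compactin (top_of_set K) (K \<inter> {\<phi>. \<not> \<phi> f})"
  proof -
    have "closed (K \<inter> {\<phi>. \<not> \<phi> f})"
      unfolding K_def by (intro closed_Int closed_primes closed_Collect_neg open_coordinate)
    then have "compact (K \<inter> {\<phi>. \<not> \<phi> f})"
      using compact_Int_closed[OF compact_bool_cube] by simp
    then show ?thesis
      by (simp add: compactin_subtopology)
  qed
  ultimately have "compactin (tensor_Spec C) (Collect ` (K \<inter> {\<phi>. \<not> \<phi> f}))"
    using image_compactin by blast
  moreover have "Collect ` (K \<inter> {\<phi>. \<not> \<phi> f}) = basic_open f"
  proof -
    have "P \<in> Collect ` (K \<inter> {\<phi>. \<not> \<phi> f})" if "P \<in> basic_open f" for P
      using that by (intro image_eqI[of _ _ "\<lambda>x. x \<in> P"]) (auto simp: K_def basic_open_def)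
    then show ?thesis
      by (auto simp: K_def basic_open_def)
  qed
  ultimately show ?thesis
    by simp
qed

lemma basic_open_Int:
  "f \<in> Arr C \<Longrightarrow> g \<in> Arr C \<Longrightarrow> basic_open f \<inter> basic_open g = basic_open (f \<boxtimes> g)"
  using tensor_primesD(3) by (auto simp: basic_open_def)

text \<open>Distinct primes differ in some arrow \<open>f\<close>, and \<open>basic_open f\<close>
  contains only the one that misses it.\<close>

lemma t0_space_Spec: "t0_space (tensor_Spec C)"
  unfolding t0_space_def topspace_Spec
proof (intro ballI impI)
  fix P Q assume PQ: "P \<in> tensor_primes C" "Q \<in> tensor_primes C" "P \<noteq> Q"
  then obtain f where f: "f \<in> P \<longleftrightarrow> f \<notin> Q"
    by blast
  then have "f \<in> Arr C"
    using idealD(1)[OF tensor_primesD(1)[OF PQ(1)]] idealD(1)[OF tensor_primesD(1)[OF PQ(2)]] by blast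
  then show "\<exists>U. openin (tensor_Spec C) U \<and> (P \<notin> U \<longleftrightarrow> Q \<in> U)"
    using f PQ by (intro exI[of _ "basic_open f"] conjI openin_basic_open) (simp_all add: basic_open_def)
qed

text \<open>No prime contains the identity of the unit object, so the whole spectrum is itself a
  basic open set.\<close>

lemma compact_space_Spec: "compact_space (tensor_Spec C)"
proof -
  have "basic_open (Id C (Unit C)) = topspace (tensor_Spec C)"
    using tensor_primesD(2) by (auto simp: basic_open_def topspace_Spec)
  then show ?thesis
    unfolding compact_space_def using compactin_basic_open by metis
qed

text \<open>If a closed set \<open>vanishing C I\<close> contains \<open>P\<close>, then
  \<open>I \<subseteq> P\<close>, so it contains every prime above \<open>P\<close>.\<close>

lemma closure_of_prime:
  assumes P: "P \<in> tensor_primes C"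
  shows "tensor_Spec C closure_of {P} = vanishing C P"
proof (rule closure_of_unique)
  show "closedin (tensor_Spec C) (vanishing C P)"
    using closedin_Spec tensor_primesD(1)[OF P] by blast
  show "{P} \<subseteq> vanishing C P"
    using P by (simp add: vanishing_def)
next
  fix Z assume Z: "{P} \<subseteq> Z" "closedin (tensor_Spec C) Z"
  then obtain I where "Z = vanishing C I"
    using closedin_Spec by blast
  then show "vanishing C P \<subseteq> Z"
    using Z by (auto simp: vanishing_def)
qed

lemma irreducible_generic_point:
  assumes Z: "closedin (tensor_Spec C) Z" "irreducible_in (tensor_Spec C) Z"
  shows "\<Inter>Z \<in> tensor_primes C" "tensor_Spec C closure_of {\<Inter>Z} = Z"
proof -
  have ne: "Z \<noteq> {}" and sub: "Z \<subseteq> tensor_primes C"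
    using Z(2) by (auto simp: irreducible_in_def topspace_Spec)
  have ideal: "tensor_ideal C (\<Inter>Z)"
    using sub tensor_primesD(1) by (intro Inter_ideal ne) blast
  obtain Q where "Q \<in> Z"
    using ne by blast
  then have "Id C (Unit C) \<notin> \<Inter>Z"
    using tensor_primesD(2)[of Q] sub by blast
  moreover have "f \<in> \<Inter>Z \<or> g \<in> \<Inter>Z" if fg: "f \<in> Arr C" "g \<in> Arr C" "f \<boxtimes> g \<in> \<Inter>Z" for f g
  proof -
    \<comment> \<open>Each member of \<open>Z\<close> contains \<open>f \<boxtimes> g\<close>, hence
      \<open>f\<close> or \<open>g\<close>. Irreducibility makes the choice uniform over
      \<open>Z\<close>, which is primality of the intersection.\<close>
    have "Z \<subseteq> (tensor_primes C - basic_open f) \<union> (tensor_primes C - basic_open g)"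
      using sub tensor_primesD(3)[OF _ fg(1,2)] fg(3) by (auto simp: basic_open_def)
    moreover have "closedin (tensor_Spec C) (tensor_primes C - basic_open h)" if "h \<in> Arr C" for h
      using openin_closedin_eq openin_basic_open[OF that] by (metis topspace_Spec)
    ultimately have "Z \<subseteq> tensor_primes C - basic_open f \<or> Z \<subseteq> tensor_primes C - basic_open g"
      using Z(2) fg(1,2) unfolding irreducible_in_def by simp
    then show ?thesis
      using sub by (auto simp: basic_open_def)
  qed
  ultimately show prime: "\<Inter>Z \<in> tensor_primes C"
    using ideal prime_proper_iff[OF ideal] unfolding tensor_primes_def prime_iff by blast
  obtain I where I: "Z = vanishing C I"
    using Z(1) closedin_Spec by blast
  \<comment> \<open>Closedness enters here: primes above the intersection contain \<open>I\<close>
    and so belong to \<open>Z\<close>. Conversely, members of \<open>Z\<close> contain the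
    intersection.\<close>
  then have "I \<subseteq> \<Inter>Z"
    by (auto simp: vanishing_def)
  then have "vanishing C (\<Inter>Z) = Z"
    using I by (auto simp: vanishing_def)
  then show "tensor_Spec C closure_of {\<Inter>Z} = Z"
    using closure_of_prime[OF prime] by simp
qed

lemma spectral_space_Spec: "spectral_space (tensor_Spec C)"
  unfolding spectral_space_def
proof (intro conjI allI impI t0_space_Spec compact_space_Spec; (elim conjE)?)
  fix U V
  assume UV: "openin (tensor_Spec C) U" "compactin (tensor_Spec C) U"
    "openin (tensor_Spec C) V" "compactin (tensor_Spec C) V"
  show "compactin (tensor_Spec C) (U \<inter> V)"
  proof (rule compactin_Int_of_basis[OF UV])
    show "openin (tensor_Spec C) B" if "B \<in> basic_open ` Arr C" for B
      using that openin_basic_open by blast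
    show "\<exists>B \<in> basic_open ` Arr C. P \<in> B \<and> B \<subseteq> W" if "openin (tensor_Spec C) W" "P \<in> W" for W P
      using basic_open_basis that by blast
    show "compactin (tensor_Spec C) (A \<inter> B)"
      if "A \<in> basic_open ` Arr C" "B \<in> basic_open ` Arr C" for A B
      using that basic_open_Int compactin_basic_open by auto
  qed
next
  show "openin (tensor_Spec C) =
      arbitrary union_of (\<lambda>U. openin (tensor_Spec C) U \<and> compactin (tensor_Spec C) U)"
    unfolding openin_topology_base_unique
  proof (intro conjI allI impI; (elim conjE)?)
    fix U P assume "openin (tensor_Spec C) U" "P \<in> U"
    from basic_open_basis[OF this] obtain f where "f \<in> Arr C" "P \<in> basic_open f" "basic_open f \<subseteq> U"
      by blast
    then show "\<exists>V. (openin (tensor_Spec C) V \<and> compactin (tensor_Spec C) V) \<and> P \<in> V \<and> V \<subseteq> U"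
      using openin_basic_open compactin_basic_open by (intro exI[of _ "basic_open f"] conjI)
  qed
next
  fix Z assume "closedin (tensor_Spec C) Z" "irreducible_in (tensor_Spec C) Z"
  then show "\<exists>P \<in> topspace (tensor_Spec C). tensor_Spec C closure_of {P} = Z"
    using irreducible_generic_point[of Z] topspace_Spec by blast
qed

end

section \<open>Functoriality\<close>

context tensor_functor
begin

text \<open>Additivity makes the image of a zero arrow idempotent under addition, hence
  zero.\<close>

lemma FArr_Zero:
  assumes "A \<in> Ob C" "B \<in> Ob C"
  shows "FArr F (Zero C A B) = Zero D (FOb F A) (FOb F B)"
proof -
  have z: "Zero C A B \<in> Hom C A B"
    using C.Zero_in_Hom assms by blast
  show ?thesis
    using D.idem_Zero[OF FArr_in_Hom[OF z]] FArr_Add[OF z z] C.Add_Zero[OF z] by simp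
qed

text \<open>\<open>F\<close> preserves tensor products only up to the isomorphisms
  \<open>FMu\<close>. Naturality says that the two arrows differ by composition with these, and
  ideals are stable under such composition.\<close>

lemma FArr_TensA_mem_iff:
  assumes P: "tensor_ideal D P" and fg: "f \<in> Hom C A A'" "g \<in> Hom C B B'"
  shows "FArr F (f \<boxtimes>\<^bsub>C\<^esub> g) \<in> P \<longleftrightarrow> FArr F f \<boxtimes>\<^bsub>D\<^esub> FArr F g \<in> P"
proof -
  let ?m = "FMu F A B" and ?m' = "FMu F A' B'"
  let ?t = "FArr F f \<boxtimes>\<^bsub>D\<^esub> FArr F g" and ?u = "FArr F (f \<boxtimes>\<^bsub>C\<^esub> g)"
  have Ob: "A \<in> Ob C" "B \<in> Ob C" "A' \<in> Ob C" "B' \<in> Ob C"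
    using C.HomD[OF fg(1)] C.HomD[OF fg(2)] by auto
  note m = FMu_in_Hom[OF Ob(1,2)] and m' = FMu_in_Hom[OF Ob(3,4)]
  note t = D.TensA_in_Hom[OF FArr_in_Hom[OF fg(1)] FArr_in_Hom[OF fg(2)]]
  note u = FArr_in_Hom[OF C.TensA_in_Hom[OF fg]]
  have nat: "?m' \<cdot>\<^bsub>D\<^esub> ?t = ?u \<cdot>\<^bsub>D\<^esub> ?m"
    using FMu_natural[OF fg] .
  \<comment> \<open>With \<open>i\<close> a right inverse of \<open>?m\<close> and \<open>j\<close>
    a left inverse of \<open>?m'\<close>, naturality yields \<open>?u\<close> as \<open>?m'\<close>
    after \<open>?t\<close> after \<open>i\<close>, and \<open>?t\<close> as \<open>j\<close> after
    \<open>?u\<close> after \<open>?m\<close>.\<close>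
  obtain i where i: "i \<in> Hom D (FOb F (A \<odot>\<^bsub>C\<^esub> B)) (FOb F A \<odot>\<^bsub>D\<^esub> FOb F B)"
      "?m \<cdot>\<^bsub>D\<^esub> i = Id D (FOb F (A \<odot>\<^bsub>C\<^esub> B))"
    using FMu_iso[OF Ob(1,2)] D.HomD[OF m] by (auto simp: iso_arr_def)
  obtain j where j: "j \<in> Hom D (FOb F (A' \<odot>\<^bsub>C\<^esub> B')) (FOb F A' \<odot>\<^bsub>D\<^esub> FOb F B')"
      "j \<cdot>\<^bsub>D\<^esub> ?m' = Id D (FOb F A' \<odot>\<^bsub>D\<^esub> FOb F B')"
    using FMu_iso[OF Ob(3,4)] D.HomD[OF m'] by (auto simp: iso_arr_def)
  have comp: "y \<cdot>\<^bsub>D\<^esub> x \<in> P" if "x \<in> P \<or> y \<in> P" "x \<in> Hom D R S" "y \<in> Hom D S T" for x y R S T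
    using that D.idealD(3,4)[OF P] D.HomD[OF that(2)] D.HomD[OF that(3)] by metis
  show ?thesis
  proof
    assume "?u \<in> P"
    then have "j \<cdot>\<^bsub>D\<^esub> (?m' \<cdot>\<^bsub>D\<^esub> ?t) \<in> P"
      using comp[OF _ D.Comp_in_Hom[OF t m'] j(1)] comp[OF _ m u] nat by simp
    then show "?t \<in> P"
      using D.Comp_assoc[OF t m' j(1)] j(2) D.Comp_Id_left[OF t] by simp
  next
    assume "?t \<in> P"
    then have "(?u \<cdot>\<^bsub>D\<^esub> ?m) \<cdot>\<^bsub>D\<^esub> i \<in> P"
      using comp[OF _ i(1) D.Comp_in_Hom[OF m u]] comp[OF _ t m'] nat by simp
    then show "?u \<in> P"
      using D.Comp_assoc[OF i(1) m u] i(2) D.Comp_Id_right[OF u] by simp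
  qed
qed

text \<open>Zero, sums and composites are preserved strictly by \<open>F\<close>, so their closure
  conditions pull back directly; only tensor stability passes through
  \<open>FArr_TensA_mem_iff\<close>.\<close>

lemma ideal_preimage_ideal:
  assumes P: "tensor_ideal D P"
  shows "tensor_ideal C (ideal_preimage C F P)"
proof -
  note PD = P[unfolded D.tensor_ideal_iff]
  have FA: "FArr F f \<in> Hom D (FOb F (Dom C f)) (FOb F (Cod C f))" if "f \<in> Arr C" for f
    using FArr_in_Hom[OF C.ArrD[OF that]] .
  have tens: "f \<boxtimes>\<^bsub>C\<^esub> g \<in> Arr C \<and>
      (FArr F (f \<boxtimes>\<^bsub>C\<^esub> g) \<in> P \<longleftrightarrow> FArr F f \<boxtimes>\<^bsub>D\<^esub> FArr F g \<in> P)"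
    if "f \<in> Arr C" "g \<in> Arr C" for f g
    using FArr_TensA_mem_iff[OF P C.ArrD C.ArrD, OF that]
      C.HomD[OF C.TensA_in_Hom[OF C.ArrD C.ArrD, OF that]] by blast
  have comp: "g \<cdot>\<^bsub>C\<^esub> f \<in> Arr C \<and> FArr F (g \<cdot>\<^bsub>C\<^esub> f) = FArr F g \<cdot>\<^bsub>D\<^esub> FArr F f"
    if "f \<in> Arr C" "g \<in> Arr C" "Dom C g = Cod C f" for f g
    using FArr_Comp[of f "Dom C f" "Cod C f" g "Cod C g"] C.ArrD[OF that(1)] C.ArrD[OF that(2)] that(3)
      C.HomD[OF C.Comp_in_Hom[of f "Dom C f" "Cod C f" g "Cod C g"]] by simp
  show ?thesis
    unfolding C.tensor_ideal_iff
  proof (intro conjI allI impI; (elim conjE)?)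
    show "ideal_preimage C F P \<subseteq> Arr C"
      by (auto simp: ideal_preimage_def)
  next
    fix A B assume "A \<in> Ob C" "B \<in> Ob C"
    then show "Zero C A B \<in> ideal_preimage C F P"
      using FArr_Zero FOb_in_Ob PD C.HomD[OF C.Zero_in_Hom] by (auto simp: ideal_preimage_def)
  next
    fix f g A B
    assume fg: "f \<in> Hom C A B" "g \<in> Hom C A B"
      and "f \<in> ideal_preimage C F P" "g \<in> ideal_preimage C F P"
    then have "FArr F f \<boxplus>\<^bsub>D\<^esub> FArr F g \<in> P"
      using PD FArr_in_Hom[OF fg(1)] FArr_in_Hom[OF fg(2)] unfolding ideal_preimage_def by blast
    then show "f \<boxplus>\<^bsub>C\<^esub> g \<in> ideal_preimage C F P"
      using FArr_Add[OF fg] C.HomD[OF C.Add_in_Hom[OF fg]] by (simp add: ideal_preimage_def)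
  next
    fix f g assume "g \<in> Arr C" "Dom C g = Cod C f" "f \<in> ideal_preimage C F P"
    then show "g \<cdot>\<^bsub>C\<^esub> f \<in> ideal_preimage C F P"
      using comp[of f g] D.idealD(3)[OF P, of "FArr F f" "FArr F g"] D.HomD[OF FA[of f]] D.HomD[OF FA[of g]]
      by (simp add: ideal_preimage_def)
  next
    fix f g assume "g \<in> Arr C" "Cod C g = Dom C f" "f \<in> ideal_preimage C F P"
    then show "f \<cdot>\<^bsub>C\<^esub> g \<in> ideal_preimage C F P"
      using comp[of g f] D.idealD(4)[OF P, of "FArr F f" "FArr F g"] D.HomD[OF FA[of f]] D.HomD[OF FA[of g]]
      by (simp add: ideal_preimage_def)
  next
    fix f g assume "g \<in> Arr C" "f \<in> ideal_preimage C F P"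
    then show "f \<boxtimes>\<^bsub>C\<^esub> g \<in> ideal_preimage C F P"
      using tens[of f g] D.idealD(5)[OF P, of "FArr F f" "FArr F g"] D.HomD[OF FA[of g]]
      by (simp add: ideal_preimage_def)
  next
    fix f g assume "g \<in> Arr C" "f \<in> ideal_preimage C F P"
    then show "g \<boxtimes>\<^bsub>C\<^esub> f \<in> ideal_preimage C F P"
      using tens[of g f] D.idealD(6)[OF P, of "FArr F f" "FArr F g"] D.HomD[OF FA[of g]]
      by (simp add: ideal_preimage_def)
  qed
qed

text \<open>Primality transfers along \<open>FArr_TensA_mem_iff\<close>. Properness rests on
  \<open>FEps\<close> being an isomorphism: it would carry the identity of \<open>?U\<close> in
  \<open>P\<close> to the identity of the unit of \<open>D\<close>.\<close>

lemma ideal_preimage_prime: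
  assumes P: "P \<in> tensor_primes D"
  shows "ideal_preimage C F P \<in> tensor_primes C"
proof -
  let ?P = "ideal_preimage C F P" and ?U = "FOb F (Unit C)"
  note ideal = D.tensor_primesD(1)[OF P]
  have FA: "FArr F f \<in> Arr D" if "f \<in> Arr C" for f
    using D.HomD[OF FArr_in_Hom[OF C.ArrD[OF that]]] by blast
  have "Id C (Unit C) \<notin> ?P"
  proof
    assume "Id C (Unit C) \<in> ?P"
    then have i: "Id D ?U \<in> P"
      using FArr_Id[OF C.Unit_in_Ob] by (simp add: ideal_preimage_def)
    note e = D.HomD[OF FEps_in_Hom] and iU = D.HomD[OF D.Id_in_Hom[OF FOb_in_Ob[OF C.Unit_in_Ob]]]
    obtain s where s: "s \<in> Hom D ?U (Unit D)" "s \<cdot>\<^bsub>D\<^esub> FEps F = Id D (Unit D)"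
      using FEps_iso e by (auto simp: iso_arr_def)
    have "Id D ?U \<cdot>\<^bsub>D\<^esub> FEps F \<in> P"
      using D.idealD(4)[OF ideal i] e iU by simp
    then have "FEps F \<in> P"
      using D.Comp_Id_left[OF FEps_in_Hom] by simp
    then have "s \<cdot>\<^bsub>D\<^esub> FEps F \<in> P"
      using D.idealD(3)[OF ideal, of "FEps F" s] e D.HomD[OF s(1)] by simp
    then show False
      using s(2) D.tensor_primesD(2)[OF P] by simp
  qed
  moreover have "f \<in> ?P \<or> g \<in> ?P" if "f \<in> Arr C" "g \<in> Arr C" "f \<boxtimes>\<^bsub>C\<^esub> g \<in> ?P" for f g
    using FArr_TensA_mem_iff[OF ideal C.ArrD[OF that(1)] C.ArrD[OF that(2)]] that FA
      D.tensor_primesD(3)[OF P, of "FArr F f" "FArr F g"] by (simp add: ideal_preimage_def)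
  ultimately show ?thesis
    using ideal_preimage_ideal[OF ideal] C.prime_proper_iff[OF ideal_preimage_ideal[OF ideal]]
    unfolding tensor_primes_def C.prime_iff by blast
qed

lemma preimage_basic_open:
  "f \<in> Arr C \<Longrightarrow>
     {P \<in> topspace (tensor_Spec D). ideal_preimage C F P \<in> C.basic_open f} = D.basic_open (FArr F f)"
  using ideal_preimage_prime
  by (auto simp: C.basic_open_def D.basic_open_def D.topspace_Spec ideal_preimage_def)

text \<open>Taking preimages commutes with unions and sends basic open sets to basic open sets.
  Arbitrary unions give continuity, and finite ones give quasi-compactness of preimages.\<close>

lemma spectral_map_ideal_preimage:
  "spectral_map (tensor_Spec D) (tensor_Spec C) (ideal_preimage C F)"
proof -
  have FA: "FArr F f \<in> Arr D" if "f \<in> Arr C" for f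
    using D.HomD[OF FArr_in_Hom[OF C.ArrD[OF that]]] by blast
  let ?pre = "\<lambda>U. {P \<in> topspace (tensor_Spec D). ideal_preimage C F P \<in> U}"
  have Union: "?pre (\<Union>\<U>) = \<Union>(?pre ` \<U>)" for \<U>
    by blast
  have "openin (tensor_Spec D) (?pre U)" if "openin (tensor_Spec C) U" for U
  proof -
    have "U = \<Union>{B \<in> C.basic_open ` Arr C. B \<subseteq> U}"
      using C.basic_open_basis[OF that] by blast
    moreover have "openin (tensor_Spec D) (\<Union>(?pre ` {B \<in> C.basic_open ` Arr C. B \<subseteq> U}))"
      using preimage_basic_open FA D.openin_basic_open by (intro openin_Union) auto
    ultimately show ?thesis
      using Union by metis
  qed
  moreover have "compactin (tensor_Spec D) (?pre U)"
    if U: "openin (tensor_Spec C) U" "compactin (tensor_Spec C) U" for U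
  proof -
    obtain \<F> where F: "finite \<F>" "\<F> \<subseteq> C.basic_open ` Arr C" "U = \<Union>\<F>"
      using compactin_openin_finite_union[OF U, of "C.basic_open ` Arr C"]
        C.basic_open_basis[OF U(1)] C.openin_basic_open by fast
    have "compactin (tensor_Spec D) (\<Union>(?pre ` \<F>))"
      using F preimage_basic_open D.compactin_basic_open by (intro compactin_Union) auto
    then show ?thesis
      using Union F(3) by metis
  qed
  ultimately show ?thesis
    using ideal_preimage_prime
    by (auto simp: spectral_map_def continuous_map_def C.topspace_Spec D.topspace_Spec)
qed

end

theorem theorem5p5:
  fixes C :: "('o, 'm) tcat"
  assumes "tensor_category C"
  shows "spectral_space (tensor_Spec C) \<and>
    (\<forall>(D :: ('p, 'n) tcat) F. tensor_functor C D F \<longrightarrow>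
       spectral_map (tensor_Spec D) (tensor_Spec C) (ideal_preimage C F))"
  using tensor_category.spectral_space_Spec[OF assms]
    tensor_functor.spectral_map_ideal_preimage by blast

end
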